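(* Let $[\mathbf G,\mathbf o]$ and $[\mathbf G',\mathbf o']$ be (not necessarily unimodular) random rooted networks. Then $[\mathbf G',\mathbf o']$ can be obtained from $[\mathbf G,\mathbf o]$ by a root-change if and only if their distributions agree on the invariant sigma-field $I$, i.e. $\mathbb P([\mathbf G,\mathbf o]\in A)=\mathbb P([\mathbf G',\mathbf o']\in A)$ for every $A\in I$.
   Context: Networks. Fix a complete separable metric space $\Xi$ (the mark space). A network is a connected, locally finite (every vertex has finite degree) multigraph $G$ with vertex set $V(G)$, together with a mark in $\Xi$ for each vertex $v$ and for each pair $(v,e)$ with $e$ an edge incident to $v$. A rooted network $(G,o)$ is a network with a distinguished vertex $o$; a doubly-rooted network $(G,o,v)$ has an ordered pair of distinguished vertices. Isomorphisms preserve marks and distinguished vertices. $\mathcal G_*$ and $\mathcal G_{**}$ are the sets of isomorphism classes $[G,o]$ and $[G,o,v]$ of rooted and doubly-rooted networks, with their Borel sigma-fields for the (Polish) local topologies: $[G_n,o_n]\to[G,o]$ iff for all $r\in\mathbb N$ and $\varepsilon>0$, for all large $n$ there is a graph isomorphism between the balls of radius $r$ about the roots that maps root to root and for which corresponding marks are at distance less than $\varepsilon$; for $\mathcal G_{**}$ one uses balls about the first root, with $r$ at least the distance of the two roots in the limit, and isomorphisms must also map second root to second root. For a function $f$ we write $f[G,o]$ for $f([G,o])$, etc. A random rooted network $[\mathbf G,\mathbf o]$ is a random element of $\mathcal G_*$. Invariant sigma-field $I$: the family of measurable $A\subseteq\mathcal G_*$ such that $[G,o]\in A$ and $v\in V(G)$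 imply $[G,v]\in A$. Root-change: let $T:\mathcal G_{**}\to\mathbb R^{\ge0}$ be measurable, write $T_G(u,v)=T[G,u,v]$ and $T_G^+(o)=\sum_{v\in V(G)}T_G(o,v)$, and assume $T_{\mathbf G}^+(\mathbf o)=1$ a.s. Any random rooted network with distribution $A\mapsto \mathbb E\big[\sum_{v\in V(\mathbf G)}T_{\mathbf G}(\mathbf o,v)1_A[\mathbf G,v]\big]$ is called the root-change of $[\mathbf G,\mathbf o]$ by kernel $T$. "Can be obtained from $[\mathbf G,\mathbf o]$ by a root-change" means that such a $T$ exists for which the root-change has the required distribution. *)

theory Defs
  imports "HOL-Probability.Probability"
begin

section \<open>Networks\<close>

text \<open>
  A connected locally finite multigraph has countably many vertices and edges, so up to isomorphism
  they may be taken to be natural numbers.  The endpoint set of an edge has two elements, or one if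
  the edge is a loop.  The mark of a pair \<open>(v, e)\<close> is \<open>emark G v e\<close>; values of the fields outside
  vertices, edges and incident pairs are ignored by isomorphism.
\<close>

record 'x network =
  verts :: "nat set"
  edges :: "nat set"
  ends :: "nat \<Rightarrow> nat set"
  vmark :: "nat \<Rightarrow> 'x"
  emark :: "nat \<Rightarrow> nat \<Rightarrow> 'x"

definition adj :: "'x network \<Rightarrow> (nat \<times> nat) set" where
  "adj G = {(u, v). \<exists>e\<in>edges G. ends G e = {u, v}}"

definition is_network :: "'x network \<Rightarrow> bool" where
  "is_network G \<longleftrightarrow>
     verts G \<noteq> {} \<and>
     (\<forall>e\<in>edges G. \<exists>u\<in>verts G. \<exists>v\<in>verts G. ends G e = {u, v}) \<and>
     (\<forall>v\<in>verts G. finite {e \<in> edges G. v \<in> ends G e}) \<and>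
     (\<forall>u\<in>verts G. \<forall>v\<in>verts G. (u, v) \<in> (adj G)\<^sup>*)"

definition gdist :: "'x network \<Rightarrow> nat \<Rightarrow> nat \<Rightarrow> nat" where
  "gdist G u v = (LEAST k. (u, v) \<in> adj G ^^ k)"

text \<open>The ball of radius \<open>r\<close> is the subnetwork induced by the vertices at distance at most \<open>r\<close>.\<close>

definition net_ball :: "'x network \<Rightarrow> nat \<Rightarrow> nat \<Rightarrow> 'x network" where
  "net_ball G u r =
     G\<lparr>verts := {v \<in> verts G. gdist G u v \<le> r},
       edges := {e \<in> edges G. ends G e \<subseteq> {v \<in> verts G. gdist G u v \<le> r}}\<rparr>"

text \<open>Multigraph isomorphisms under which corresponding marks are related by \<open>P\<close>.\<close>

definition net_iso ::
  "('x \<Rightarrow> 'x \<Rightarrow> bool) \<Rightarrow> 'x network \<Rightarrow> 'x network \<Rightarrow> (nat \<Rightarrow> nat) \<Rightarrow> (nat \<Rightarrow> nat) \<Rightarrow> bool" where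
  "net_iso P G H f g \<longleftrightarrow>
     bij_betw f (verts G) (verts H) \<and> bij_betw g (edges G) (edges H) \<and>
     (\<forall>e\<in>edges G. ends H (g e) = f ` ends G e) \<and>
     (\<forall>v\<in>verts G. P (vmark G v) (vmark H (f v))) \<and>
     (\<forall>e\<in>edges G. \<forall>v\<in>ends G e. P (emark G v e) (emark H (f v) (g e)))"

definition rooted_iso :: "'x network \<times> nat \<Rightarrow> 'x network \<times> nat \<Rightarrow> bool" where
  "rooted_iso = (\<lambda>(G, u) (H, u').
     is_network G \<and> is_network H \<and> u \<in> verts G \<and> u' \<in> verts H \<and>
     (\<exists>f g. net_iso (=) G H f g \<and> f u = u'))"

definition doubly_rooted_iso :: "'x network \<times> nat \<times> nat \<Rightarrow> 'x network \<times> nat \<times> nat \<Rightarrow> bool" where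
  "doubly_rooted_iso = (\<lambda>(G, u, v) (H, u', v').
     is_network G \<and> is_network H \<and> u \<in> verts G \<and> u' \<in> verts H \<and> v \<in> verts G \<and> v' \<in> verts H \<and>
     (\<exists>f g. net_iso (=) G H f g \<and> f u = u' \<and> f v = v'))"

lemma is_network_ends: "is_network G \<Longrightarrow> e \<in> edges G \<Longrightarrow> ends G e \<subseteq> verts G"
  unfolding is_network_def by (metis insert_subset empty_subsetI)

lemma net_isoD:
  assumes "net_iso P G H f g"
  shows "inj_on f (verts G)" "f ` verts G = verts H" "inj_on g (edges G)" "g ` edges G = edges H"
    and "e \<in> edges G \<Longrightarrow> ends H (g e) = f ` ends G e"
    and "v \<in> verts G \<Longrightarrow> P (vmark G v) (vmark H (f v))"
    and "e \<in> edges G \<Longrightarrow> v \<in> ends G e \<Longrightarrow> P (emark G v e) (emark H (f v) (g e))"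
    and "v \<in> verts G \<Longrightarrow> f v \<in> verts H" "e \<in> edges G \<Longrightarrow> g e \<in> edges H"
  using assms unfolding net_iso_def bij_betw_def by blast+

lemma net_iso_id: "net_iso (=) G G id id"
  by (simp add: net_iso_def)

lemma net_iso_mono:
  assumes "net_iso P G H f g" "\<And>a b. P a b \<Longrightarrow> Q a b"
  shows "net_iso Q G H f g"
  using assms unfolding net_iso_def by simp

lemma net_iso_comp:
  assumes 1: "net_iso P G H f g" and 2: "net_iso Q H K f' g'"
    and tr: "\<And>a b c. P a b \<Longrightarrow> Q b c \<Longrightarrow> R a c"
  shows "net_iso R G K (f' \<circ> f) (g' \<circ> g)"
  unfolding net_iso_def
proof (intro conjI ballI)
  have "bij_betw f (verts G) (verts H)" "bij_betw f' (verts H) (verts K)"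
    and "bij_betw g (edges G) (edges H)" "bij_betw g' (edges H) (edges K)"
    using 1 2 by (simp_all add: net_iso_def)
  then show "bij_betw (f' \<circ> f) (verts G) (verts K)" "bij_betw (g' \<circ> g) (edges G) (edges K)"
    by (simp_all add: bij_betw_trans)
next
  fix v assume v: "v \<in> verts G"
  show "R (vmark G v) (vmark K ((f' \<circ> f) v))"
    unfolding comp_apply
    by (rule tr[OF net_isoD(6)[OF 1 v] net_isoD(6)[OF 2 net_isoD(8)[OF 1 v]]])
next
  fix e assume e: "e \<in> edges G"
  note ge = net_isoD(9)[OF 1 e]
  show "ends K ((g' \<circ> g) e) = (f' \<circ> f) ` ends G e"
    unfolding comp_apply net_isoD(5)[OF 2 ge] net_isoD(5)[OF 1 e] image_image ..
  fix v assume v: "v \<in> ends G e"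
  then have "f v \<in> ends H (g e)"
    unfolding net_isoD(5)[OF 1 e] by (rule imageI)
  then show "R (emark G v e) (emark K ((f' \<circ> f) v) ((g' \<circ> g) e))"
    unfolding comp_apply
    by (rule tr[OF net_isoD(7)[OF 1 e v] net_isoD(7)[OF 2 ge]])
qed

lemma net_iso_inv:
  assumes iso: "net_iso P G H f g" and sub: "\<And>e. e \<in> edges G \<Longrightarrow> ends G e \<subseteq> verts G"
  shows "net_iso (\<lambda>a b. P b a) H G (inv_into (verts G) f) (inv_into (edges G) g)"
  unfolding net_iso_def
proof (intro conjI ballI)
  show "bij_betw (inv_into (verts G) f) (verts H) (verts G)"
    and "bij_betw (inv_into (edges G) g) (edges H) (edges G)"
    using iso unfolding net_iso_def by (blast intro: bij_betw_inv_into)+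
next
  fix v assume "v \<in> verts H"
  then obtain v' where v': "v = f v'" "v' \<in> verts G"
    unfolding net_isoD(2)[OF iso, symmetric] by (rule imageE)
  then show "P (vmark G (inv_into (verts G) f v)) (vmark H v)"
    using net_isoD(6)[OF iso v'(2)] by (simp add: inv_into_f_f[OF net_isoD(1)[OF iso]])
next
  fix e assume "e \<in> edges H"
  then obtain e' where e': "e = g e'" "e' \<in> edges G"
    unfolding net_isoD(4)[OF iso, symmetric] by (rule imageE)
  note inv_e = inv_into_f_f[OF net_isoD(3)[OF iso] e'(2)]
  show "ends G (inv_into (edges G) g e) = inv_into (verts G) f ` ends H e"
    unfolding e'(1) inv_e net_isoD(5)[OF iso e'(2)]
    using inv_into_image_cancel[OF net_isoD(1)[OF iso] sub[OF e'(2)]] by (rule sym)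
  fix v assume "v \<in> ends H e"
  then obtain v' where v': "v = f v'" "v' \<in> ends G e'"
    unfolding e'(1) net_isoD(5)[OF iso e'(2)] by (rule imageE)
  have "v' \<in> verts G"
    using sub[OF e'(2)] v'(2) by blast
  then show "P (emark G (inv_into (verts G) f v) (inv_into (edges G) g e)) (emark H v e)"
    unfolding e'(1) inv_e v'(1) inv_into_f_f[OF net_isoD(1)[OF iso] \<open>v' \<in> verts G\<close>]
    by (intro net_isoD(7)[OF iso] e' v')
qed

lemma net_iso_sym:
  assumes "net_iso (=) G H f g" "is_network G" "u \<in> verts G"
  obtains f' g' where "net_iso (=) H G f' g'" "f' (f u) = u" "\<And>v. v \<in> verts G \<Longrightarrow> f' (f v) = v"
proof
  show "net_iso (=) H G (inv_into (verts G) f) (inv_into (edges G) g)"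
    using net_iso_mono[OF net_iso_inv[OF assms(1) is_network_ends[OF assms(2)]]] by simp
  show "inv_into (verts G) f (f v) = v" if "v \<in> verts G" for v
    by (rule inv_into_f_f[OF net_isoD(1)[OF assms(1)] that])
  then show "inv_into (verts G) f (f u) = u"
    using assms(3) .
qed

lemma is_network_exists: "\<exists>G :: 'x network. is_network G \<and> 0 \<in> verts G"
  by (rule exI[of _ "\<lparr>verts = {0}, edges = {}, ends = (\<lambda>_. {}), vmark = undefined, emark = undefined\<rparr>"])
     (simp add: is_network_def)

lemma rooted_iso_refl: "is_network G \<Longrightarrow> u \<in> verts G \<Longrightarrow> rooted_iso (G, u) (G, u)"
  by (auto simp: rooted_iso_def net_iso_id intro!: exI[of _ id])

lemma doubly_rooted_iso_refl:
  "is_network G \<Longrightarrow> u \<in> verts G \<Longrightarrow> v \<in> verts G \<Longrightarrow> doubly_rooted_iso (G, u, v) (G, u, v)"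
  by (auto simp: doubly_rooted_iso_def net_iso_id intro!: exI[of _ id])

lemma rooted_iso_sym: "rooted_iso x y \<Longrightarrow> rooted_iso y x"
proof -
  assume *: "rooted_iso x y"
  obtain G u where x: "x = (G, u)" by (cases x)
  obtain H u' where y: "y = (H, u')" by (cases y)
  obtain f g where fg: "net_iso (=) G H f g" "f u = u'"
    using * unfolding x y rooted_iso_def by auto
  have G: "is_network G" "u \<in> verts G"
    using * unfolding x y rooted_iso_def by auto
  obtain f' g' where "net_iso (=) H G f' g'" "f' u' = u"
    using net_iso_sym[OF fg(1) G(1,2)] fg(2) G(2) by blast
  then show ?thesis
    using * unfolding x y rooted_iso_def by auto
qed

lemma rooted_iso_trans: "rooted_iso x y \<Longrightarrow> rooted_iso y z \<Longrightarrow> rooted_iso x z"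
proof -
  assume *: "rooted_iso x y" "rooted_iso y z"
  obtain G u where x: "x = (G, u)" by (cases x)
  obtain H u' where y: "y = (H, u')" by (cases y)
  obtain K u'' where z: "z = (K, u'')" by (cases z)
  obtain f g where 1: "net_iso (=) G H f g" "f u = u'"
    using *(1) unfolding x y rooted_iso_def by auto
  obtain f' g' where 2: "net_iso (=) H K f' g'" "f' u' = u''"
    using *(2) unfolding y z rooted_iso_def by auto
  have "net_iso (=) G K (f' \<circ> f) (g' \<circ> g)"
    using 1(1) 2(1) by (rule net_iso_comp) simp
  moreover have "(f' \<circ> f) u = u''"
    using 1 2 by simp_all
  ultimately show ?thesis
    using * unfolding x y z rooted_iso_def by auto
qed

lemma doubly_rooted_iso_sym: "doubly_rooted_iso x y \<Longrightarrow> doubly_rooted_iso y x"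
proof -
  assume *: "doubly_rooted_iso x y"
  obtain G u v where x: "x = (G, u, v)" by (cases x rule: prod_cases3)
  obtain H u' v' where y: "y = (H, u', v')" by (cases y rule: prod_cases3)
  obtain f g where fg: "net_iso (=) G H f g" "f u = u'" "f v = v'"
    using * unfolding x y doubly_rooted_iso_def by auto
  have G: "is_network G" "u \<in> verts G" "v \<in> verts G"
    using * unfolding x y doubly_rooted_iso_def by auto
  obtain f' g' where "net_iso (=) H G f' g'" "f' u' = u" "f' v' = v"
    using net_iso_sym[OF fg(1) G(1,2)] fg(2,3) G(2,3) by blast
  then show ?thesis
    using * unfolding x y doubly_rooted_iso_def by auto
qed

lemma doubly_rooted_iso_trans: "doubly_rooted_iso x y \<Longrightarrow> doubly_rooted_iso y z \<Longrightarrow> doubly_rooted_iso x z"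
proof -
  assume *: "doubly_rooted_iso x y" "doubly_rooted_iso y z"
  obtain G u v where x: "x = (G, u, v)" by (cases x rule: prod_cases3)
  obtain H u' v' where y: "y = (H, u', v')" by (cases y rule: prod_cases3)
  obtain K u'' v'' where z: "z = (K, u'', v'')" by (cases z rule: prod_cases3)
  obtain f g where 1: "net_iso (=) G H f g" "f u = u'" "f v = v'"
    using *(1) unfolding x y doubly_rooted_iso_def by auto
  obtain f' g' where 2: "net_iso (=) H K f' g'" "f' u' = u''" "f' v' = v''"
    using *(2) unfolding y z doubly_rooted_iso_def by auto
  have "net_iso (=) G K (f' \<circ> f) (g' \<circ> g)"
    using 1(1) 2(1) by (rule net_iso_comp) simp
  moreover have "(f' \<circ> f) u = u''" "(f' \<circ> f) v = v''"
    using 1 2 by simp_all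
  ultimately show ?thesis
    using * unfolding x y z doubly_rooted_iso_def by auto
qed

quotient_type 'x rooted_network = "'x network \<times> nat" / partial: rooted_iso
proof (intro part_equivpI sympI transpI)
  obtain G :: "'x network" where "is_network G" "0 \<in> verts G"
    using is_network_exists by blast
  then show "\<exists>x :: 'x network \<times> nat. rooted_iso x x"
    by (intro exI[of _ "(G, 0)"] rooted_iso_refl)
qed (fact rooted_iso_sym rooted_iso_trans)+

quotient_type 'x doubly_rooted_network = "'x network \<times> nat \<times> nat" / partial: doubly_rooted_iso
proof (intro part_equivpI sympI transpI)
  obtain G :: "'x network" where "is_network G" "0 \<in> verts G"
    using is_network_exists by blast
  then show "\<exists>x :: 'x network \<times> nat \<times> nat. doubly_rooted_iso x x"
    by (intro exI[of _ "(G, 0, 0)"] doubly_rooted_iso_refl)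
qed (fact doubly_rooted_iso_sym doubly_rooted_iso_trans)+

text \<open>
  The classes \<open>[G, u]\<close> and \<open>[G, u, v]\<close>, meaningful only for networks \<open>G\<close> with vertices \<open>u\<close>, \<open>v\<close>.
\<close>

definition rooted :: "'x network \<Rightarrow> nat \<Rightarrow> 'x rooted_network" where
  "rooted G u = abs_rooted_network (G, u)"

definition doubly_rooted :: "'x network \<Rightarrow> nat \<Rightarrow> nat \<Rightarrow> 'x doubly_rooted_network" where
  "doubly_rooted G u v = abs_doubly_rooted_network (G, u, v)"

lemma rooted_eqI: "rooted_iso (G, u) (H, u') \<Longrightarrow> rooted G u = rooted H u'"
  unfolding rooted_def by (rule Quotient3_rel_abs[OF Quotient3_rooted_network])

lemma rooted_eqD:
  "\<lbrakk>is_network G; u \<in> verts G; is_network H; u' \<in> verts H; rooted G u = rooted H u'\<rbrakk> \<Longrightarrow>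
   rooted_iso (G, u) (H, u')"
  unfolding rooted_def
  by (rule Quotient3_rel[OF Quotient3_rooted_network, THEN iffD1]) (simp add: rooted_iso_refl)

lemma doubly_rooted_eqI:
  "doubly_rooted_iso (G, u, v) (H, u', v') \<Longrightarrow> doubly_rooted G u v = doubly_rooted H u' v'"
  unfolding doubly_rooted_def by (rule Quotient3_rel_abs[OF Quotient3_doubly_rooted_network])

lemma doubly_rooted_eqD:
  "\<lbrakk>is_network G; u \<in> verts G; v \<in> verts G; is_network H; u' \<in> verts H; v' \<in> verts H;
    doubly_rooted G u v = doubly_rooted H u' v'\<rbrakk> \<Longrightarrow> doubly_rooted_iso (G, u, v) (H, u', v')"
  unfolding doubly_rooted_def
  by (rule Quotient3_rel[OF Quotient3_doubly_rooted_network, THEN iffD1]) (simp add: doubly_rooted_iso_refl)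

lemma rooted_exhaust:
  obtains G u where "is_network G" "u \<in> verts G" "x = rooted G u"
proof -
  obtain G u where "rep_rooted_network x = (G, u)" by fastforce
  moreover have "rooted_iso (rep_rooted_network x) (rep_rooted_network x)"
    and "abs_rooted_network (rep_rooted_network x) = x"
    by (rule Quotient3_rep_reflp[OF Quotient3_rooted_network]
             Quotient3_abs_rep[OF Quotient3_rooted_network])+
  ultimately show ?thesis
    using that[of G u] by (auto simp: rooted_iso_def rooted_def)
qed

lemma doubly_rooted_exhaust:
  obtains G u v where "is_network G" "u \<in> verts G" "v \<in> verts G" "x = doubly_rooted G u v"
proof -
  obtain G u v where "rep_doubly_rooted_network x = (G, u, v)"
    by (cases "rep_doubly_rooted_network x" rule: prod_cases3)
  moreover have "doubly_rooted_iso (rep_doubly_rooted_network x) (rep_doubly_rooted_network x)"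
    and "abs_doubly_rooted_network (rep_doubly_rooted_network x) = x"
    by (rule Quotient3_rep_reflp[OF Quotient3_doubly_rooted_network]
             Quotient3_abs_rep[OF Quotient3_doubly_rooted_network])+
  ultimately show ?thesis
    using that[of G u v] by (auto simp: doubly_rooted_iso_def doubly_rooted_def)
qed

section \<open>The local topologies\<close>

lemma net_ball_simps [simp]:
  "verts (net_ball G u r) = {v \<in> verts G. gdist G u v \<le> r}"
  "edges (net_ball G u r) = {e \<in> edges G. ends G e \<subseteq> {v \<in> verts G. gdist G u v \<le> r}}"
  "ends (net_ball G u r) = ends G" "vmark (net_ball G u r) = vmark G" "emark (net_ball G u r) = emark G"
  by (simp_all add: net_ball_def)

lemma gdist_refl [simp]: "gdist G u u = 0"
  by (simp add: gdist_def)

lemma adj_relpow_map: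
  assumes iso: "net_iso P G H f g"
  shows "(u, v) \<in> adj G ^^ k \<Longrightarrow> (f u, f v) \<in> adj H ^^ k"
proof (induction k arbitrary: v)
  case (Suc k)
  from Suc.prems obtain w where w: "(u, w) \<in> adj G ^^ k" "(w, v) \<in> adj G"
    by (rule relpow_Suc_E)
  then obtain e where e: "e \<in> edges G" "ends G e = {w, v}"
    by (auto simp: adj_def)
  have "(f w, f v) \<in> adj H"
    using net_isoD(9)[OF iso e(1)] net_isoD(5)[OF iso e(1)] e(2) by (auto simp: adj_def)
  with Suc.IH[OF w(1)] show ?case
    by (rule relpow_Suc_I)
qed simp

lemma gdist_iso:
  assumes iso: "net_iso P G H f g" and G: "is_network G" "u \<in> verts G" "v \<in> verts G"
  shows "gdist H (f u) (f v) = gdist G u v"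
proof -
  let ?f = "inv_into (verts G) f"
  have "?f (f u) = u" "?f (f v) = v"
    using G inv_into_f_f[OF net_isoD(1)[OF iso]] by simp_all
  then have "(f u, f v) \<in> adj H ^^ k \<longleftrightarrow> (u, v) \<in> adj G ^^ k" for k
    using adj_relpow_map[OF iso, of u v k]
      adj_relpow_map[OF net_iso_inv[OF iso is_network_ends[OF G(1)]], of "f u" "f v" k] by auto
  then show ?thesis
    by (simp add: gdist_def)
qed

lemma net_iso_ball:
  assumes iso: "net_iso P G H f g" and G: "is_network G" "u \<in> verts G"
  shows "net_iso P (net_ball G u r) (net_ball H (f u) r) f g"
proof -
  let ?B = "{v \<in> verts G. gdist G u v \<le> r}" and ?C = "{v \<in> verts H. gdist H (f u) v \<le> r}"
  note inj = net_isoD(1)[OF iso] and inj' = net_isoD(3)[OF iso]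
  have B: "f ` ?B = ?C"
    using gdist_iso[OF iso G] unfolding net_isoD(2)[OF iso, symmetric] by auto
  have sub: "ends H (g e) \<subseteq> ?C \<longleftrightarrow> ends G e \<subseteq> ?B" if "e \<in> edges G" for e
    unfolding net_isoD(5)[OF iso that] B[symmetric]
    by (rule inj_on_image_subset_iff[OF inj is_network_ends[OF G(1) that]]) blast
  have E: "g ` {e \<in> edges G. ends G e \<subseteq> ?B} = {e \<in> edges H. ends H e \<subseteq> ?C}"
    unfolding net_isoD(4)[OF iso, symmetric] using sub by blast
  show ?thesis
    unfolding net_iso_def net_ball_simps
  proof (intro conjI ballI)
    show "bij_betw f ?B ?C"
      unfolding bij_betw_def using B inj by (blast intro: inj_on_subset)
    show "bij_betw g {e \<in> edges G. ends G e \<subseteq> ?B} {e \<in> edges H. ends H e \<subseteq> ?C}"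
      unfolding bij_betw_def using E inj' by (blast intro: inj_on_subset)
  qed (use net_isoD(5,6,7)[OF iso] in blast)+
qed

lemma ball_iso_transport:
  assumes "net_iso (=) G G' a b" "net_iso (=) H H' c d"
    and G: "is_network G" "is_network G'" "u \<in> verts G" and H: "is_network H" "u' \<in> verts H"
    and iso: "net_iso P (net_ball G u r) (net_ball H u' r) f g"
  shows "\<exists>f' g'. net_iso P (net_ball G' (a u) r) (net_ball H' (c u') r) f' g' \<and>
           (\<forall>v\<in>verts G. f' (a v) = c (f v))"
proof -
  obtain a' b' where a': "net_iso (=) G' G a' b'" "a' (a u) = u" "\<And>v. v \<in> verts G \<Longrightarrow> a' (a v) = v"
    by (rule net_iso_sym[OF assms(1) G(1,3)]) (rule that)
  have "net_iso (=) (net_ball G' (a u) r) (net_ball G u r) a' b'"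
    using net_iso_ball[OF a'(1) G(2) net_isoD(8)[OF assms(1) G(3)]] a'(2) by simp
  then have "net_iso P (net_ball G' (a u) r) (net_ball H u' r) (f \<circ> a') (g \<circ> b')"
    using iso by (rule net_iso_comp) simp
  then have "net_iso P (net_ball G' (a u) r) (net_ball H' (c u') r) (c \<circ> (f \<circ> a')) (d \<circ> (g \<circ> b'))"
    using net_iso_ball[OF assms(2) H] by (rule net_iso_comp) simp
  moreover have "\<forall>v\<in>verts G. (c \<circ> (f \<circ> a')) (a v) = c (f v)"
    using a'(3) by simp
  ultimately show ?thesis
    by blast
qed

definition near_rep ::
  "nat \<Rightarrow> real \<Rightarrow> 'x::metric_space network \<times> nat \<Rightarrow> 'x network \<times> nat \<Rightarrow> bool" where
  "near_rep r \<epsilon> = (\<lambda>(G, u) (H, u').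
     \<exists>f g. net_iso (\<lambda>a b. dist a b < \<epsilon>) (net_ball G u r) (net_ball H u' r) f g \<and> f u = u')"

definition doubly_near_rep ::
  "nat \<Rightarrow> real \<Rightarrow> 'x::metric_space network \<times> nat \<times> nat \<Rightarrow> 'x network \<times> nat \<times> nat \<Rightarrow> bool" where
  "doubly_near_rep r \<epsilon> = (\<lambda>(G, u, v) (H, u', v').
     \<exists>f g. net_iso (\<lambda>a b. dist a b < \<epsilon>) (net_ball G u r) (net_ball H u' r) f g \<and>
       f u = u' \<and> f v = v')"

lemma near_rep_cong:
  assumes "rooted_iso x x'" "rooted_iso y y'" "near_rep r \<epsilon> x y"
  shows "near_rep r \<epsilon> x' y'"
proof -
  obtain G u where x: "x = (G, u)" by (cases x)
  obtain G' w where x': "x' = (G', w)" by (cases x')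
  obtain H u' where y: "y = (H, u')" by (cases y)
  obtain H' w' where y': "y' = (H', w')" by (cases y')
  obtain a b where 1: "net_iso (=) G G' a b" "a u = w"
    using assms(1) unfolding x x' rooted_iso_def by auto
  obtain c d where 2: "net_iso (=) H H' c d" "c u' = w'"
    using assms(2) unfolding y y' rooted_iso_def by auto
  have net: "is_network G" "is_network G'" "u \<in> verts G" "is_network H" "u' \<in> verts H"
    using assms(1,2) unfolding x x' y y' rooted_iso_def by auto
  obtain f g where fg: "net_iso (\<lambda>a b. dist a b < \<epsilon>) (net_ball G u r) (net_ball H u' r) f g" "f u = u'"
    using assms(3) unfolding x y near_rep_def by auto
  obtain f' g' where "net_iso (\<lambda>a b. dist a b < \<epsilon>) (net_ball G' w r) (net_ball H' w' r) f' g'"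
    and "\<forall>v\<in>verts G. f' (a v) = c (f v)"
    using ball_iso_transport[OF 1(1) 2(1) net fg(1)] unfolding 1(2) 2(2) by blast
  moreover from this(2) have "f' w = w'"
    using net(3) fg(2) 1(2) 2(2) by auto
  ultimately show ?thesis
    unfolding x' y' near_rep_def by auto
qed

lemma doubly_near_rep_cong:
  assumes "doubly_rooted_iso x x'" "doubly_rooted_iso y y'" "doubly_near_rep r \<epsilon> x y"
  shows "doubly_near_rep r \<epsilon> x' y'"
proof -
  obtain G u v where x: "x = (G, u, v)" by (cases x rule: prod_cases3)
  obtain G' w z where x': "x' = (G', w, z)" by (cases x' rule: prod_cases3)
  obtain H u' v' where y: "y = (H, u', v')" by (cases y rule: prod_cases3)
  obtain H' w' z' where y': "y' = (H', w', z')" by (cases y' rule: prod_cases3)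
  obtain a b where 1: "net_iso (=) G G' a b" "a u = w" "a v = z"
    using assms(1) unfolding x x' doubly_rooted_iso_def by auto
  obtain c d where 2: "net_iso (=) H H' c d" "c u' = w'" "c v' = z'"
    using assms(2) unfolding y y' doubly_rooted_iso_def by auto
  have net: "is_network G" "is_network G'" "u \<in> verts G" "is_network H" "u' \<in> verts H"
    and v: "v \<in> verts G"
    using assms(1,2) unfolding x x' y y' doubly_rooted_iso_def by auto
  obtain f g where fg: "net_iso (\<lambda>a b. dist a b < \<epsilon>) (net_ball G u r) (net_ball H u' r) f g"
    "f u = u'" "f v = v'"
    using assms(3) unfolding x y doubly_near_rep_def by auto
  obtain f' g' where "net_iso (\<lambda>a b. dist a b < \<epsilon>) (net_ball G' w r) (net_ball H' w' r) f' g'"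
    and "\<forall>v\<in>verts G. f' (a v) = c (f v)"
    using ball_iso_transport[OF 1(1) 2(1) net fg(1)] unfolding 1(2) 2(2) by blast
  moreover from this(2) have "f' w = w'" "f' z = z'"
    using net(3) v fg(2,3) 1(2,3) 2(2,3) by auto
  ultimately show ?thesis
    unfolding x' y' doubly_near_rep_def by auto
qed

lift_definition near :: "nat \<Rightarrow> real \<Rightarrow> 'x::metric_space rooted_network \<Rightarrow> 'x rooted_network \<Rightarrow> bool"
  is near_rep
  by (rule iffI) (erule (2) near_rep_cong, erule near_rep_cong[OF rooted_iso_sym rooted_iso_sym])

lift_definition doubly_near ::
  "nat \<Rightarrow> real \<Rightarrow> 'x::metric_space doubly_rooted_network \<Rightarrow> 'x doubly_rooted_network \<Rightarrow> bool"
  is doubly_near_rep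
  by (rule iffI)
     (erule (2) doubly_near_rep_cong,
      erule doubly_near_rep_cong[OF doubly_rooted_iso_sym doubly_rooted_iso_sym])

lift_definition root_dist :: "'x doubly_rooted_network \<Rightarrow> nat"
  is "\<lambda>(G, u, v). gdist G u v"
  by (auto simp: doubly_rooted_iso_def gdist_iso)

definition local_limit :: "(nat \<Rightarrow> 'x::metric_space rooted_network) \<Rightarrow> 'x rooted_network \<Rightarrow> bool" where
  "local_limit s x \<longleftrightarrow> (\<forall>r. \<forall>\<epsilon>>0. \<forall>\<^sub>F n in sequentially. near r \<epsilon> x (s n))"

definition doubly_local_limit ::
  "(nat \<Rightarrow> 'x::metric_space doubly_rooted_network) \<Rightarrow> 'x doubly_rooted_network \<Rightarrow> bool" where
  "doubly_local_limit s x \<longleftrightarrow>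
     (\<forall>r\<ge>root_dist x. \<forall>\<epsilon>>0. \<forall>\<^sub>F n in sequentially. doubly_near r \<epsilon> x (s n))"

text \<open>
  The local topologies are metrizable, hence determined by their convergent sequences: the open
  sets are the sequentially open ones.  That these topologies have the prescribed convergent
  sequences is shown in \<open>tendsto_iff_local_limit\<close> and \<open>tendsto_iff_doubly_local_limit\<close>.
\<close>

instantiation rooted_network :: (metric_space) topological_space
begin

definition open_rooted_network :: "'a rooted_network set \<Rightarrow> bool" where
  "open_rooted_network U \<longleftrightarrow>
     (\<forall>s. \<forall>x\<in>U. local_limit s x \<longrightarrow> (\<forall>\<^sub>F n in sequentially. s n \<in> U))"

instance
proof
  show "open (S \<inter> T)" if "open S" "open T" for S T :: "'a rooted_network set"
    using that unfolding open_rooted_network_def by (simp add: eventually_conj_iff) blast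
  show "open (\<Union>K)" if "\<forall>S\<in>K. open S" for K :: "'a rooted_network set set"
    using that unfolding open_rooted_network_def by (blast intro: eventually_mono)
qed (simp add: open_rooted_network_def)

end

instantiation doubly_rooted_network :: (metric_space) topological_space
begin

definition open_doubly_rooted_network :: "'a doubly_rooted_network set \<Rightarrow> bool" where
  "open_doubly_rooted_network U \<longleftrightarrow>
     (\<forall>s. \<forall>x\<in>U. doubly_local_limit s x \<longrightarrow> (\<forall>\<^sub>F n in sequentially. s n \<in> U))"

instance
proof
  show "open (S \<inter> T)" if "open S" "open T" for S T :: "'a doubly_rooted_network set"
    using that unfolding open_doubly_rooted_network_def by (simp add: eventually_conj_iff) blast
  show "open (\<Union>K)" if "\<forall>S\<in>K. open S" for K :: "'a doubly_rooted_network set set"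
    using that unfolding open_doubly_rooted_network_def by (blast intro: eventually_mono)
qed (simp add: open_doubly_rooted_network_def)

end

lemma near_rooted:
  "\<lbrakk>is_network G; u \<in> verts G; is_network H; u' \<in> verts H\<rbrakk> \<Longrightarrow>
   near r \<epsilon> (rooted G u) (rooted H u') \<longleftrightarrow> near_rep r \<epsilon> (G, u) (H, u')"
  unfolding rooted_def by (rule near.abs_eq) (rule rooted_iso_refl; assumption)+

lemma doubly_near_doubly_rooted:
  "\<lbrakk>is_network G; u \<in> verts G; v \<in> verts G; is_network H; u' \<in> verts H; v' \<in> verts H\<rbrakk> \<Longrightarrow>
   doubly_near r \<epsilon> (doubly_rooted G u v) (doubly_rooted H u' v') \<longleftrightarrow>
   doubly_near_rep r \<epsilon> (G, u, v) (H, u', v')"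
  unfolding doubly_rooted_def by (rule doubly_near.abs_eq) (rule doubly_rooted_iso_refl; assumption)+

lemma root_dist_doubly_rooted:
  "\<lbrakk>is_network G; u \<in> verts G; v \<in> verts G\<rbrakk> \<Longrightarrow> root_dist (doubly_rooted G u v) = gdist G u v"
  unfolding doubly_rooted_def using root_dist.abs_eq[OF doubly_rooted_iso_refl] by fastforce

lemma finite_net_ball:
  assumes G: "is_network G" "u \<in> verts G"
  shows "finite (verts (net_ball G u r))" "finite (edges (net_ball G u r))"
proof -
  have fin: "finite {e \<in> edges G. v \<in> ends G e}" if "v \<in> verts G" for v
    using G(1) that by (simp add: is_network_def)
  have fin_adj: "finite (adj G `` {v}) \<and> adj G `` {v} \<subseteq> verts G" if v: "v \<in> verts G" for v
  proof
    have "finite (ends G e)" if "e \<in> edges G" for e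
    proof -
      have "\<exists>a\<in>verts G. \<exists>b\<in>verts G. ends G e = {a, b}"
        using G(1) that by (simp add: is_network_def)
      then show ?thesis by auto
    qed
    then have "finite (\<Union>e\<in>{e \<in> edges G. v \<in> ends G e}. ends G e)"
      using fin[OF v] by simp
    moreover have "adj G `` {v} \<subseteq> (\<Union>e\<in>{e \<in> edges G. v \<in> ends G e}. ends G e)"
      by (auto simp: adj_def)
    ultimately show "finite (adj G `` {v})"
      by (rule finite_subset[rotated])
    show "adj G `` {v} \<subseteq> verts G"
      using is_network_ends[OF G(1)] by (auto simp: adj_def)
  qed
  have *: "finite ((adj G ^^ k) `` {u}) \<and> (adj G ^^ k) `` {u} \<subseteq> verts G" for k
  proof (induction k)
    case 0
    then show ?case using G(2) by simp
  next
    case (Suc k)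
    have "(adj G ^^ Suc k) `` {u} = (\<Union>v\<in>(adj G ^^ k) `` {u}. adj G `` {v})"
      by auto
    then show ?case
      using Suc.IH fin_adj by (simp add: subset_iff) blast
  qed
  have "(u, v) \<in> adj G ^^ gdist G u v" if "v \<in> verts G" for v
  proof -
    have "(u, v) \<in> (adj G)\<^sup>*"
      using G that by (simp add: is_network_def)
    then obtain k where "(u, v) \<in> adj G ^^ k"
      using rtrancl_imp_relpow by blast
    then show ?thesis
      unfolding gdist_def by (rule LeastI)
  qed
  then have "verts (net_ball G u r) \<subseteq> (\<Union>k\<le>r. (adj G ^^ k) `` {u})"
    by auto
  then show V: "finite (verts (net_ball G u r))"
    by (rule finite_subset) (use * in simp)
  have "edges (net_ball G u r) \<subseteq> (\<Union>v\<in>verts (net_ball G u r). {e \<in> edges G. v \<in> ends G e})"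
  proof
    fix e assume e: "e \<in> edges (net_ball G u r)"
    then have "\<exists>a\<in>verts G. \<exists>b\<in>verts G. ends G e = {a, b}"
      using G(1) by (simp add: is_network_def)
    then obtain a where "a \<in> ends G e" by auto
    with e show "e \<in> (\<Union>v\<in>verts (net_ball G u r). {e \<in> edges G. v \<in> ends G e})"
      by auto
  qed
  then show "finite (edges (net_ball G u r))"
    by (rule finite_subset) (intro finite_UN_I V, use fin in simp)
qed

lemma net_iso_dist_strict:
  fixes G H :: "'x::metric_space network"
  assumes iso: "net_iso (\<lambda>a b. dist a b < \<epsilon>) G H f g"
    and fin: "finite (verts G)" "finite (edges G)" and sub: "\<And>e. e \<in> edges G \<Longrightarrow> ends G e \<subseteq> verts G"
  obtains \<delta> where "\<delta> > 0" "net_iso (\<lambda>a b. dist a b < \<epsilon> - \<delta>) G H f g"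
proof -
  define S where "S = (\<lambda>v. dist (vmark G v) (vmark H (f v))) ` verts G \<union>
    (\<lambda>(e, v). dist (emark G v e) (emark H (f v) (g e))) ` (SIGMA e:edges G. ends G e)"
  have "finite S"
    unfolding S_def using fin finite_subset[OF sub fin(1)] by blast
  have "\<forall>t\<in>S. t < \<epsilon>"
    using net_isoD(6,7)[OF iso] unfolding S_def by auto
  with \<open>finite S\<close> have "\<exists>\<delta>>0. \<forall>t\<in>S. t < \<epsilon> - \<delta>"
  proof (induction S rule: finite_induct)
    case empty
    show ?case by (rule exI[of _ 1]) simp
  next
    case (insert t S)
    then obtain \<delta> where \<delta>: "\<delta> > 0" "\<forall>t\<in>S. t < \<epsilon> - \<delta>" by auto
    have "t < \<epsilon>" using insert.prems by simp
    with \<delta> show ?case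
      by (intro exI[of _ "min \<delta> ((\<epsilon> - t) / 2)"]) (auto simp: min_def field_simps)
  qed
  then obtain \<delta> where \<delta>: "\<delta> > 0" "\<And>t. t \<in> S \<Longrightarrow> t < \<epsilon> - \<delta>" by blast
  have "net_iso (\<lambda>a b. dist a b < \<epsilon> - \<delta>) G H f g"
    using iso unfolding net_iso_def by (auto intro!: \<delta>(2) simp: S_def)
  with \<delta>(1) show thesis
    by (rule that)
qed

lemma net_ball_strict:
  fixes G H :: "'x::metric_space network"
  assumes "is_network G" "u \<in> verts G"
    and iso: "net_iso (\<lambda>a b. dist a b < \<epsilon>) (net_ball G u r) (net_ball H u' r) f g"
  obtains \<delta> where "\<delta> > 0"
    "\<And>K q f' g'. net_iso (\<lambda>a b. dist a b < \<delta>) (net_ball H u' r) (net_ball K q r) f' g' \<Longrightarrow>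
       net_iso (\<lambda>a b. dist a b < \<epsilon>) (net_ball G u r) (net_ball K q r) (f' \<circ> f) (g' \<circ> g)"
proof -
  obtain \<delta> where \<delta>: "\<delta> > 0"
    "net_iso (\<lambda>a b. dist a b < \<epsilon> - \<delta>) (net_ball G u r) (net_ball H u' r) f g"
  proof (rule net_iso_dist_strict[OF iso finite_net_ball[OF assms(1,2)]])
    show "ends (net_ball G u r) e \<subseteq> verts (net_ball G u r)" if "e \<in> edges (net_ball G u r)" for e
      using that by simp
  qed
  have "net_iso (\<lambda>a b. dist a b < \<epsilon>) (net_ball G u r) (net_ball K q r) (f' \<circ> f) (g' \<circ> g)"
    if "net_iso (\<lambda>a b. dist a b < \<delta>) (net_ball H u' r) (net_ball K q r) f' g'" for K q f' g'
  proof (rule net_iso_comp[OF \<delta>(2) that])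
    fix a b c :: 'x assume "dist a b < \<epsilon> - \<delta>" "dist b c < \<delta>"
    then show "dist a c < \<epsilon>"
      using dist_triangle[of a c b] by linarith
  qed
  with \<delta>(1) show thesis
    by (rule that)
qed

lemma near_refl: "\<epsilon> > 0 \<Longrightarrow> near r \<epsilon> x x"
proof -
  assume "\<epsilon> > 0"
  obtain G u where x: "is_network G" "u \<in> verts G" "x = rooted G u"
    by (rule rooted_exhaust)
  have "net_iso (\<lambda>a b. dist a b < \<epsilon>) (net_ball G u r) (net_ball G u r) id id"
    using \<open>\<epsilon> > 0\<close> by (intro net_iso_mono[OF net_iso_id]) simp
  then show ?thesis
    unfolding x(3) near_rooted[OF x(1,2) x(1,2)] near_rep_def by auto
qed

lemma doubly_near_refl: "\<epsilon> > 0 \<Longrightarrow> doubly_near r \<epsilon> x x"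
proof -
  assume "\<epsilon> > 0"
  obtain G u v where x: "is_network G" "u \<in> verts G" "v \<in> verts G" "x = doubly_rooted G u v"
    by (rule doubly_rooted_exhaust)
  have "net_iso (\<lambda>a b. dist a b < \<epsilon>) (net_ball G u r) (net_ball G u r) id id"
    using \<open>\<epsilon> > 0\<close> by (intro net_iso_mono[OF net_iso_id]) simp
  then show ?thesis
    unfolding x(4) doubly_near_doubly_rooted[OF x(1-3) x(1-3)] doubly_near_rep_def by auto
qed

lemma open_near: "open {y. near r \<epsilon> x y}"
  unfolding open_rooted_network_def
proof (intro allI ballI impI)
  fix s y assume y: "y \<in> {y. near r \<epsilon> x y}" and s: "local_limit s y"
  obtain G u where x: "is_network G" "u \<in> verts G" "x = rooted G u"
    by (rule rooted_exhaust)
  obtain H u' where H: "is_network H" "u' \<in> verts H" "y = rooted H u'"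
    by (rule rooted_exhaust)
  obtain f g where fg: "net_iso (\<lambda>a b. dist a b < \<epsilon>) (net_ball G u r) (net_ball H u' r) f g" "f u = u'"
    using y near_rooted[OF x(1,2) H(1,2)] unfolding x(3) H(3) near_rep_def by auto
  obtain \<delta> where \<delta>: "\<delta> > 0"
    "\<And>K q f' g'. net_iso (\<lambda>a b. dist a b < \<delta>) (net_ball H u' r) (net_ball K q r) f' g' \<Longrightarrow>
       net_iso (\<lambda>a b. dist a b < \<epsilon>) (net_ball G u r) (net_ball K q r) (f' \<circ> f) (g' \<circ> g)"
    by (rule net_ball_strict[OF x(1,2) fg(1)]) (rule that)
  have "\<forall>\<^sub>F n in sequentially. near r \<delta> y (s n)"
    using s \<delta>(1) by (simp add: local_limit_def)
  then show "\<forall>\<^sub>F n in sequentially. s n \<in> {y. near r \<epsilon> x y}"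
  proof (rule eventually_mono)
    fix n assume n: "near r \<delta> y (s n)"
    obtain K q where K: "is_network K" "q \<in> verts K" "s n = rooted K q"
      by (rule rooted_exhaust)
    obtain f' g' where "net_iso (\<lambda>a b. dist a b < \<delta>) (net_ball H u' r) (net_ball K q r) f' g'" "f' u' = q"
      using n near_rooted[OF H(1,2) K(1,2)] unfolding H(3) K(3) near_rep_def by auto
    then have "near_rep r \<epsilon> (G, u) (K, q)"
      using \<delta>(2) fg(2) unfolding near_rep_def prod.case by (metis comp_apply)
    then show "s n \<in> {y. near r \<epsilon> x y}"
      unfolding K(3) x(3) by (simp add: near_rooted x(1,2) K(1,2))
  qed
qed

lemma open_doubly_near:
  assumes r: "root_dist x \<le> r"
  shows "open {y. doubly_near r \<epsilon> x y}"
  unfolding open_doubly_rooted_network_def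
proof (intro allI ballI impI)
  fix s y assume y: "y \<in> {y. doubly_near r \<epsilon> x y}" and s: "doubly_local_limit s y"
  obtain G u v where x: "is_network G" "u \<in> verts G" "v \<in> verts G" "x = doubly_rooted G u v"
    by (rule doubly_rooted_exhaust)
  obtain H u' v' where H: "is_network H" "u' \<in> verts H" "v' \<in> verts H" "y = doubly_rooted H u' v'"
    by (rule doubly_rooted_exhaust)
  obtain f g where fg: "net_iso (\<lambda>a b. dist a b < \<epsilon>) (net_ball G u r) (net_ball H u' r) f g"
    "f u = u'" "f v = v'"
    using y doubly_near_doubly_rooted[OF x(1-3) H(1-3)] unfolding x(4) H(4) doubly_near_rep_def by auto
  have "v \<in> verts (net_ball G u r)"
    using r x by (simp add: root_dist_doubly_rooted)
  then have "root_dist y \<le> r"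
    using net_isoD(8)[OF fg(1)] fg(3) H by (auto simp: root_dist_doubly_rooted)
  obtain \<delta> where \<delta>: "\<delta> > 0"
    "\<And>K q f' g'. net_iso (\<lambda>a b. dist a b < \<delta>) (net_ball H u' r) (net_ball K q r) f' g' \<Longrightarrow>
       net_iso (\<lambda>a b. dist a b < \<epsilon>) (net_ball G u r) (net_ball K q r) (f' \<circ> f) (g' \<circ> g)"
    by (rule net_ball_strict[OF x(1,2) fg(1)]) (rule that)
  have "\<forall>\<^sub>F n in sequentially. doubly_near r \<delta> y (s n)"
    using s \<delta>(1) \<open>root_dist y \<le> r\<close> by (simp add: doubly_local_limit_def)
  then show "\<forall>\<^sub>F n in sequentially. s n \<in> {y. doubly_near r \<epsilon> x y}"
  proof (rule eventually_mono)
    fix n assume n: "doubly_near r \<delta> y (s n)"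
    obtain K q q' where K: "is_network K" "q \<in> verts K" "q' \<in> verts K" "s n = doubly_rooted K q q'"
      by (rule doubly_rooted_exhaust)
    obtain f' g' where "net_iso (\<lambda>a b. dist a b < \<delta>) (net_ball H u' r) (net_ball K q r) f' g'"
      "f' u' = q" "f' v' = q'"
      using n doubly_near_doubly_rooted[OF H(1-3) K(1-3)] unfolding H(4) K(4) doubly_near_rep_def by auto
    then have "doubly_near_rep r \<epsilon> (G, u, v) (K, q, q')"
      using \<delta>(2) fg(2,3) unfolding doubly_near_rep_def prod.case by (metis comp_apply)
    then show "s n \<in> {y. doubly_near r \<epsilon> x y}"
      unfolding K(4) x(4) by (simp add: doubly_near_doubly_rooted x(1-3) K(1-3))
  qed
qed

lemma tendsto_iff_local_limit: "s \<longlonglongrightarrow> x \<longleftrightarrow> local_limit s x"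
proof
  assume s: "s \<longlonglongrightarrow> x"
  show "local_limit s x"
    unfolding local_limit_def
  proof (intro allI impI)
    fix r :: nat and \<epsilon> :: real assume "\<epsilon> > 0"
    then have "\<forall>\<^sub>F n in sequentially. s n \<in> {y. near r \<epsilon> x y}"
      by (intro topological_tendstoD[OF s open_near] CollectI near_refl)
    then show "\<forall>\<^sub>F n in sequentially. near r \<epsilon> x (s n)"
      by simp
  qed
next
  assume "local_limit s x"
  then show "s \<longlonglongrightarrow> x"
    unfolding tendsto_def open_rooted_network_def by blast
qed

lemma tendsto_iff_doubly_local_limit: "s \<longlonglongrightarrow> x \<longleftrightarrow> doubly_local_limit s x"
proof
  assume s: "s \<longlonglongrightarrow> x"
  show "doubly_local_limit s x"
    unfolding doubly_local_limit_def
  proof (intro allI impI)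
    fix r :: nat and \<epsilon> :: real assume "root_dist x \<le> r" "\<epsilon> > 0"
    then have "\<forall>\<^sub>F n in sequentially. s n \<in> {y. doubly_near r \<epsilon> x y}"
      by (intro topological_tendstoD[OF s open_doubly_near] CollectI doubly_near_refl)
    then show "\<forall>\<^sub>F n in sequentially. doubly_near r \<epsilon> x (s n)"
      by simp
  qed
next
  assume "doubly_local_limit s x"
  then show "s \<longlonglongrightarrow> x"
    unfolding tendsto_def open_doubly_rooted_network_def by blast
qed

section \<open>Invariant sets and root-changes\<close>

definition invariant_sets :: "'x::metric_space rooted_network set set" where
  "invariant_sets = {A \<in> sets borel.
     \<forall>G. is_network G \<longrightarrow> (\<forall>u\<in>verts G. \<forall>v\<in>verts G. rooted G u \<in> A \<longrightarrow> rooted G v \<in> A)}"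

lemma sigma_algebra_invariant_sets:
  "sigma_algebra UNIV (invariant_sets :: 'x::metric_space rooted_network set set)"
proof -
  have compl: "UNIV - A \<in> invariant_sets" if "A \<in> invariant_sets" for A :: "'x rooted_network set"
  proof -
    have "UNIV - A \<in> sets borel"
      using that sets.compl_sets[of A borel] by (simp add: invariant_sets_def)
    then show ?thesis
      using that by (auto simp: invariant_sets_def)
  qed
  have "(\<Union>i. A i) \<in> invariant_sets" if A: "range A \<subseteq> invariant_sets"
    for A :: "nat \<Rightarrow> 'x rooted_network set"
  proof -
    have A': "A i \<in> invariant_sets" for i
      using A by auto
    then have "(\<Union>i. A i) \<in> sets borel"
      by (intro sets.countable_UN) (auto simp: invariant_sets_def)
    moreover have "rooted G v \<in> A i"
      if "is_network G" "u \<in> verts G" "v \<in> verts G" "rooted G u \<in> A i" for G u v i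
      using A'[of i] that unfolding invariant_sets_def by blast
    ultimately show ?thesis
      unfolding invariant_sets_def mem_Collect_eq by (intro conjI allI impI ballI) (assumption, blast)
  qed
  moreover have "{} \<in> invariant_sets"
    by (simp add: invariant_sets_def)
  ultimately show ?thesis
    unfolding sigma_algebra_iff2 using compl by simp
qed

lemma rooted_map:
  assumes "net_iso (=) G H f g" "is_network G" "is_network H" "v \<in> verts G"
  shows "rooted H (f v) = rooted G v"
  using assms net_isoD(8)[OF assms(1,4)] by (intro rooted_eqI[symmetric]) (auto simp: rooted_iso_def)

lemma doubly_rooted_map:
  assumes "net_iso (=) G H f g" "is_network G" "is_network H" "u \<in> verts G" "v \<in> verts G"
  shows "doubly_rooted H (f u) (f v) = doubly_rooted G u v"
  using assms net_isoD(8)[OF assms(1,4)] net_isoD(8)[OF assms(1,5)]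
  by (intro doubly_rooted_eqI[symmetric]) (auto simp: doubly_rooted_iso_def)

text \<open>\<open>out_mass T [G, u]\<close> is \<open>T\<^sub>G\<^sup>+(u)\<close>.\<close>

lift_definition out_mass :: "('x doubly_rooted_network \<Rightarrow> real) \<Rightarrow> 'x rooted_network \<Rightarrow> ennreal"
  is "\<lambda>T (G, u). \<integral>\<^sup>+ v. ennreal (T (doubly_rooted G u v)) \<partial>count_space (verts G)"
proof (clarsimp simp: rooted_iso_def)
  fix T :: "'x doubly_rooted_network \<Rightarrow> real" and G H :: "'x network" and u f g
  assume *: "net_iso (=) G H f g" "is_network G" "is_network H" "u \<in> verts G"
  have "bij_betw f (verts G) (verts H)"
    using *(1) by (simp add: net_iso_def)
  from nn_integral_bij_count_space[OF this, of "\<lambda>v. ennreal (T (doubly_rooted H (f u) v))"]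
  show "(\<integral>\<^sup>+ v. ennreal (T (doubly_rooted G u v)) \<partial>count_space (verts G)) =
      (\<integral>\<^sup>+ v. ennreal (T (doubly_rooted H (f u) v)) \<partial>count_space (verts H))"
    by (rule trans[rotated]) (auto intro!: nn_integral_cong simp: doubly_rooted_map[OF *])
qed

lift_definition mass_into ::
  "('x doubly_rooted_network \<Rightarrow> real) \<Rightarrow> 'x rooted_network set \<Rightarrow> 'x rooted_network \<Rightarrow> ennreal"
  is "\<lambda>T A (G, u).
    \<integral>\<^sup>+ v. ennreal (T (doubly_rooted G u v)) * indicator A (rooted G v) \<partial>count_space (verts G)"
proof (clarsimp simp: rooted_iso_def)
  fix T :: "'x doubly_rooted_network \<Rightarrow> real" and A and G H :: "'x network" and u f g
  assume *: "net_iso (=) G H f g" "is_network G" "is_network H" "u \<in> verts G"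
  have "bij_betw f (verts G) (verts H)"
    using *(1) by (simp add: net_iso_def)
  from nn_integral_bij_count_space[OF this,
      of "\<lambda>v. ennreal (T (doubly_rooted H (f u) v)) * indicator A (rooted H v)"]
  show "(\<integral>\<^sup>+ v. ennreal (T (doubly_rooted G u v)) * indicator A (rooted G v) \<partial>count_space (verts G)) =
      (\<integral>\<^sup>+ v. ennreal (T (doubly_rooted H (f u) v)) * indicator A (rooted H v) \<partial>count_space (verts H))"
    by (rule trans[rotated])
       (auto intro!: nn_integral_cong simp: doubly_rooted_map[OF *] rooted_map[OF *(1-3)])
qed

lemma out_mass_rooted:
  "\<lbrakk>is_network G; u \<in> verts G\<rbrakk> \<Longrightarrow>
   out_mass T (rooted G u) = (\<integral>\<^sup>+ v. ennreal (T (doubly_rooted G u v)) \<partial>count_space (verts G))"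
  unfolding rooted_def[of G u] using out_mass.abs_eq[OF rooted_iso_refl] by fastforce

lemma mass_into_rooted:
  "\<lbrakk>is_network G; u \<in> verts G\<rbrakk> \<Longrightarrow> mass_into T A (rooted G u) =
   (\<integral>\<^sup>+ v. ennreal (T (doubly_rooted G u v)) * indicator A (rooted G v) \<partial>count_space (verts G))"
  unfolding rooted_def[of G u] using mass_into.abs_eq[OF rooted_iso_refl] by fastforce

definition random_rooted_network :: "'a measure \<Rightarrow> ('a \<Rightarrow> 'x::metric_space rooted_network) \<Rightarrow> bool" where
  "random_rooted_network M X \<longleftrightarrow> prob_space M \<and> X \<in> borel_measurable M"

definition is_root_change ::
  "('x::metric_space doubly_rooted_network \<Rightarrow> real) \<Rightarrow> 'a measure \<Rightarrow> ('a \<Rightarrow> 'x rooted_network) \<Rightarrow>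
   'b measure \<Rightarrow> ('b \<Rightarrow> 'x rooted_network) \<Rightarrow> bool" where
  "is_root_change T M X M' X' \<longleftrightarrow>
     T \<in> borel_measurable borel \<and> (\<forall>z. 0 \<le> T z) \<and>
     (AE \<omega> in M. out_mass T (X \<omega>) = 1) \<and>
     (\<forall>A\<in>sets borel.
        emeasure M' {\<omega> \<in> space M'. X' \<omega> \<in> A} = (\<integral>\<^sup>+ \<omega>. mass_into T A (X \<omega>) \<partial>M))"

end

theory Submission
  imports Defs
begin

text \<open>
  A root-change moves the root only within its network, so it cannot alter the probability of an
  event that does not see the root; this is the easy direction
  (\<open>root_change_preserves_invariant\<close>).

  For the converse, let \<open>\<mu>\<close> and \<open>\<nu>\<close> be the two laws. Fix one kernel \<open>K\<close> that moves the root of \<open>G\<close>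
  from \<open>u\<close> to each vertex \<open>v\<close> with positive weights of sum at most one, namely
  \<open>2\<^sup>-\<^sup>d\<^sup>-\<^sup>1\<close> divided by the size of the ball of radius \<open>d\<close> about \<open>u\<close>, where \<open>d\<close> is the distance from \<open>u\<close>
  to \<open>v\<close>. Transport \<open>\<mu>\<close> to \<open>\<nu>\<close> greedily in rounds. In each round, let \<open>K\<close> spread the part of
  \<open>\<mu>\<close> that is still unused, let each network accept the arriving mass up to the part of \<open>\<nu>\<close> that is still missing
  there, and let the rejected mass stay at its origin for the next round. A round uses the kernel
  \<open>a(u) K(u, v) b(v)\<close>, where \<open>a\<close> is the unused fraction at \<open>u\<close> and \<open>b\<close> the accepted fraction at \<open>v\<close>,
  so the sum over the rounds is a function of the doubly-rooted network.

  Nothing is left in the limit. What arrives from the unused mass \<open>\<mu>\<^sub>\<infinity>\<close> is singular to the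
  missing mass \<open>\<nu>\<^sub>\<infinity>\<close>, because the accepted masses of all rounds have a finite sum
  (\<open>leftovers_singular\<close>). So \<open>\<nu>\<^sub>\<infinity>\<close> lives on a set \<open>A\<close> that \<open>K\<close> does not reach from
  \<open>\<mu>\<^sub>\<infinity>\<close>. As \<open>K\<close> charges every vertex, \<open>\<mu>\<^sub>\<infinity>\<close> vanishes on the saturation \<open>B\<close> of \<open>A\<close>,
  the set of all networks that some change of the root brings into \<open>A\<close>. But \<open>B\<close> is invariant, every
  round removes equal masses of \<open>\<mu>\<close> and \<open>\<nu>\<close> from an invariant set, and the two laws agree there at the
  start. Hence \<open>\<nu>\<^sub>\<infinity>\<close> vanishes on \<open>B\<close>, which contains \<open>A\<close>, and so altogether; comparing total masses,
  \<open>\<mu>\<^sub>\<infinity>\<close> vanishes as well (\<open>no_leftovers\<close>).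

  This argument is carried out for an arbitrary kernel that charges exactly the classes of an
  equivalence relation. For networks one has to check that \<open>K\<close> is measurable
  (\<open>measurable_spread_kernel\<close>). On an open set \<open>U\<close> the function \<open>K(\<cdot>, U)\<close> is lower semicontinuous,
  because an approximate isomorphism of large balls carries finitely many admissible new roots to
  admissible new roots with the same weights (\<open>open_mass_into_spread\<close>); the open sets generate the
  Borel sets.
\<close>

section \<open>Transport along a kernel that charges equivalence classes\<close>

lemma ennreal_summand_le: "a + b = c \<Longrightarrow> a \<le> (c :: ennreal)"
  by auto

text \<open>
  If \<open>d n\<close> is taken from the stock \<open>s n\<close> in round \<open>n\<close>, the amounts taken and the amount that survives all
  rounds add up to the initial stock.
\<close>
lemma suminf_plus_INF:
  fixes s d :: "nat \<Rightarrow> ennreal"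
  assumes step: "\<And>n. d n + s (Suc n) = s n"
  shows "(\<Sum>n. d n) + (INF n. s n) = s 0"
proof -
  have "decseq s"
    by (rule decseq_SucI) (rule ennreal_summand_le[OF trans[OF add.commute step]])
  then have "(\<lambda>n. (\<Sum>i<n. d i) + s n) \<longlonglongrightarrow> (\<Sum>n. d n) + (INF n. s n)"
    by (intro tendsto_add LIMSEQ_INF summable_LIMSEQ summableI)
  moreover have "(\<Sum>i<n. d i) + s n = s 0" for n
    by (induction n) (simp_all add: add.assoc step)
  ultimately show ?thesis
    by (simp add: LIMSEQ_const_iff)
qed

lemma bounded_multiples_zero:
  fixes c B :: ennreal
  assumes "\<And>n. of_nat n * c \<le> B" and "B < \<infinity>"
  shows "c = 0"
proof (rule ccontr)
  assume "c \<noteq> 0"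
  have "(SUP n. of_nat n * c) = (SUP n. of_nat n) * c"
    by (rule SUP_mult_right_ennreal[symmetric])
  also have "\<dots> = \<infinity>"
    using \<open>c \<noteq> 0\<close> by (simp add: ennreal_SUP_of_nat_eq_top ennreal_top_mult)
  finally have SUP: "(SUP n. of_nat n * c) = \<infinity>" .
  have "(SUP n. of_nat n * c) \<le> B"
    by (rule SUP_least) (rule assms(1))
  then show False
    unfolding SUP using assms(2) by (simp add: top_unique)
qed

text \<open>
  An equivalence relation with a kernel \<open>K\<close> whose measure \<open>K x\<close> lives on the class of \<open>x\<close> and charges each
  measurable set that meets this class. The second property makes the saturation of a measurable set
  measurable, which it need not be for a general measurable equivalence relation.
\<close>
locale class_kernel =
  fixes S :: "'s measure" and K :: "'s \<Rightarrow> 's measure" and E :: "'s \<Rightarrow> 's \<Rightarrow> bool"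
  assumes kernel [measurable]: "K \<in> S \<rightarrow>\<^sub>M subprob_algebra S"
    and equiv: "equivp E"
    and null_iff: "\<lbrakk>x \<in> space S; A \<in> sets S\<rbrakk> \<Longrightarrow> emeasure (K x) A = 0 \<longleftrightarrow> (\<forall>y\<in>A. \<not> E x y)"
begin

definition invariant :: "'s set \<Rightarrow> bool" where
  "invariant A \<longleftrightarrow> A \<in> sets S \<and> (\<forall>x\<in>A. \<forall>y\<in>space S. E x y \<longrightarrow> y \<in> A)"

definition avg :: "('s \<Rightarrow> ennreal) \<Rightarrow> 's \<Rightarrow> ennreal" where
  "avg \<phi> x = (\<integral>\<^sup>+ y. \<phi> y \<partial>K x)"

text \<open>
  The union of the classes that meet \<open>A\<close>, expressed through \<open>K\<close> to make it visibly measurable.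
\<close>
definition saturation :: "'s set \<Rightarrow> 's set" where
  "saturation A = {x \<in> space S. emeasure (K x) A \<noteq> 0}"

lemma measurable_avg [measurable]:
  assumes [measurable]: "\<phi> \<in> borel_measurable S"
  shows "avg \<phi> \<in> borel_measurable S"
proof -
  note nn_integral_measurable_subprob_algebra [measurable]
  show ?thesis
    unfolding avg_def[abs_def] by measurable
qed

lemma sets_K: "x \<in> space S \<Longrightarrow> sets (K x) = sets S"
  using sets_kernel[OF kernel] .

lemma avg_indicator: "\<lbrakk>x \<in> space S; A \<in> sets S\<rbrakk> \<Longrightarrow> avg (indicator A) x = emeasure (K x) A"
  by (simp add: avg_def sets_K)

lemma avg_le_1:
  assumes x: "x \<in> space S" and le: "\<And>y. \<phi> y \<le> 1"
  shows "avg \<phi> x \<le> 1"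
proof -
  have "avg \<phi> x \<le> (\<integral>\<^sup>+ y. 1 \<partial>K x)"
    unfolding avg_def by (intro nn_integral_mono le)
  also have "\<dots> \<le> 1"
    using subprob_space.subprob_emeasure_le_1[OF subprob_space_kernel[OF kernel x]] by simp
  finally show ?thesis .
qed

lemma invariant_saturation:
  assumes [measurable]: "A \<in> sets S"
  shows "invariant (saturation A)"
proof -
  have [measurable]: "(\<lambda>x. emeasure (K x) A) \<in> borel_measurable S"
    using measurable_emeasure_subprob_algebra[OF assms] kernel by (rule measurable_compose[rotated])
  have "saturation A \<in> sets S"
    unfolding saturation_def by measurable
  moreover have "E y z" if "E x y" "E x z" for x y z
    using that equiv by (meson equivp_def equivp_symp equivp_transp)
  ultimately show ?thesis
    unfolding invariant_def saturation_def using null_iff[OF _ assms] by blast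
qed

lemma saturation_superset:
  assumes "A \<in> sets S"
  shows "A \<subseteq> saturation A"
  using null_iff[OF _ assms] equivp_reflp[OF equiv] sets.sets_into_space[OF assms]
  unfolding saturation_def by blast

text \<open>
  \<open>K x\<close> lives on the class of \<open>x\<close>, which lies either inside or outside an invariant set.
\<close>
lemma avg_indicator_invariant:
  assumes C: "invariant C" and x: "x \<in> space S" and \<phi>: "\<phi> \<in> borel_measurable S"
  shows "avg (\<lambda>y. \<phi> y * indicator C y) x = avg \<phi> x * indicator C x"
proof (cases "x \<in> C")
  case True
  have "emeasure (K x) (space S - C) = 0"
    using C True x by (subst null_iff) (auto simp: invariant_def)
  then have "AE y in K x. y \<in> C"
    using C sets_K[OF x] by (intro AE_I[of _ _ "space S - C"]) (auto simp: invariant_def dest: sets_eq_imp_space_eq)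
  then have "AE y in K x. \<phi> y * indicator C y = \<phi> y"
    by eventually_elim simp
  then show ?thesis
    unfolding avg_def using True by (simp add: nn_integral_cong_AE)
next
  case False
  have "emeasure (K x) C = 0"
    using C False x equivp_symp[OF equiv] by (subst null_iff) (auto simp: invariant_def)
  then have "AE y in K x. y \<notin> C"
    using C sets_K[OF x] by (intro AE_I[of _ _ C]) (auto simp: invariant_def)
  then have "AE y in K x. \<phi> y * indicator C y = 0"
    by eventually_elim simp
  then have "avg (\<lambda>y. \<phi> y * indicator C y) x = (\<integral>\<^sup>+ y. 0 \<partial>K x)"
    unfolding avg_def by (rule nn_integral_cong_AE)
  then show ?thesis
    using False by simp
qed

end

text \<open>
  The situation of the converse: two finite measures that agree on the invariant sets. The image \<open>\<kappa>\<close> of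
  the first one under \<open>K\<close> serves as reference measure. It dominates the second measure and the image of every part of the first, so
  that the minimum of two measures becomes the pointwise minimum of their densities.
\<close>
locale equidistributed = class_kernel +
  fixes \<mu> \<nu> :: "'a measure"
  assumes fin_mu: "finite_measure \<mu>" and fin_nu: "finite_measure \<nu>"
    and sets_mu [measurable_cong]: "sets \<mu> = sets S" and sets_nu [measurable_cong]: "sets \<nu> = sets S"
    and agree: "invariant A \<Longrightarrow> emeasure \<mu> A = emeasure \<nu> A"
begin

definition \<kappa> :: "'a measure" where "\<kappa> = \<mu> \<bind> K"

lemma space_mu [simp]: "space \<mu> = space S"
  using sets_eq_imp_space_eq[OF sets_mu] .

lemma sets_bind_K:
  assumes "sets M = sets S"
  shows "sets (M \<bind> K) = sets S"
proof (cases "space M = {}")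
  case True
  then have "space S = {}"
    using sets_eq_imp_space_eq[OF assms] by simp
  with True show ?thesis
    using sets_eq_imp_space_eq[OF assms] by (metis bind_empty sets_eq_iff_bounded sets.empty_sets
      space_count_space sets.space_closed space_empty)
next
  case False
  then show ?thesis
    using sets_eq_imp_space_eq[OF assms] by (intro sets_bind sets_K) auto
qed

lemma nn_integral_bind_K:
  assumes "\<phi> \<in> borel_measurable S" and "sets M = sets S"
  shows "(\<integral>\<^sup>+ y. \<phi> y \<partial>(M \<bind> K)) = (\<integral>\<^sup>+ x. avg \<phi> x \<partial>M)"
  unfolding avg_def
  by (rule nn_integral_bind[OF assms(1)]) (simp add: measurable_cong_sets[OF assms(2) refl] kernel)

lemma finite_bind_K:
  assumes fin: "finite_measure M" and sets: "sets M = sets S"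
  shows "finite_measure (M \<bind> K)"
proof
  interpret finite_measure M by fact
  have "emeasure (M \<bind> K) (space (M \<bind> K)) = (\<integral>\<^sup>+ y. 1 \<partial>(M \<bind> K))"
    by simp
  also have "\<dots> = (\<integral>\<^sup>+ x. avg (\<lambda>_. 1) x \<partial>M)"
    by (rule nn_integral_bind_K) (simp_all add: sets)
  also have "\<dots> \<le> (\<integral>\<^sup>+ x. 1 \<partial>M)"
    by (intro nn_integral_mono avg_le_1) (simp_all add: sets_eq_imp_space_eq[OF sets])
  also have "\<dots> < \<infinity>"
    using emeasure_finite[of "space M"] by (simp add: less_top[symmetric])
  finally show "emeasure (M \<bind> K) (space (M \<bind> K)) \<noteq> \<infinity>"
    by simp
qed

lemma sets_kappa [simp, measurable_cong]: "sets \<kappa> = sets S"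
  unfolding \<kappa>_def by (rule sets_bind_K[OF sets_mu])

lemma space_kappa [simp]: "space \<kappa> = space S"
  using sets_eq_imp_space_eq[OF sets_kappa] .

lemma finite_kappa: "finite_measure \<kappa>"
  unfolding \<kappa>_def by (rule finite_bind_K[OF fin_mu sets_mu])

lemma nn_integral_kappa:
  "\<phi> \<in> borel_measurable S \<Longrightarrow> (\<integral>\<^sup>+ y. \<phi> y \<partial>\<kappa>) = (\<integral>\<^sup>+ x. avg \<phi> x \<partial>\<mu>)"
  unfolding \<kappa>_def by (rule nn_integral_bind_K[OF _ sets_mu])

lemma emeasure_kappa_eq_0_iff:
  assumes A [measurable]: "A \<in> sets S"
  shows "emeasure \<kappa> A = 0 \<longleftrightarrow> emeasure \<mu> (saturation A) = 0"
proof -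
  have [measurable]: "(\<lambda>x. emeasure (K x) A) \<in> borel_measurable S"
    using measurable_emeasure_subprob_algebra[OF A] kernel by (rule measurable_compose[rotated])
  have "emeasure \<kappa> A = (\<integral>\<^sup>+ x. avg (indicator A) x \<partial>\<mu>)"
    using nn_integral_kappa[of "indicator A"] A by simp
  also have "\<dots> = (\<integral>\<^sup>+ x. emeasure (K x) A \<partial>\<mu>)"
    by (intro nn_integral_cong) (simp add: avg_indicator A)
  also have "\<dots> = 0 \<longleftrightarrow> emeasure \<mu> {x \<in> space \<mu>. emeasure (K x) A \<noteq> 0} = 0"
    by (rule nn_integral_0_iff) measurable
  finally show ?thesis
    by (simp add: saturation_def)
qed

text \<open>
  A \<open>\<kappa>\<close>-null set has a \<open>\<mu>\<close>-null saturation. That is an invariant set, so it is also \<open>\<nu>\<close>-null.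
\<close>
lemma nu_absolutely_continuous: "absolutely_continuous \<kappa> \<nu>"
  unfolding absolutely_continuous_def
proof
  fix A assume "A \<in> null_sets \<kappa>"
  then have A: "A \<in> sets S" "emeasure \<kappa> A = 0"
    by auto
  have "emeasure \<nu> A \<le> emeasure \<nu> (saturation A)"
    using saturation_superset[OF A(1)] invariant_saturation[OF A(1)]
    by (intro emeasure_mono) (auto simp: invariant_def sets_nu)
  also have "\<dots> = emeasure \<mu> (saturation A)"
    using agree[OF invariant_saturation[OF A(1)]] by simp
  also have "\<dots> = 0"
    using A emeasure_kappa_eq_0_iff by simp
  finally show "A \<in> null_sets \<nu>"
    using A by (simp add: null_sets_def sets_nu)
qed

section \<open>Densities with respect to the image measure\<close>

text \<open>
  A Radon--Nikodym density with respect to \<open>\<kappa>\<close> that is finite everywhere, not only almost everywhere.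
  Finiteness at each point makes the quotient of densities in \<open>acceptance\<close> behave well there.
\<close>
definition density_of :: "'a measure \<Rightarrow> 'a \<Rightarrow> ennreal" where
  "density_of N = (SOME f. f \<in> borel_measurable S \<and> (\<forall>x. f x < \<infinity>) \<and> density \<kappa> f = N)"

lemma density_of:
  assumes fin: "finite_measure N" and ac: "absolutely_continuous \<kappa> N" and sets: "sets N = sets S"
  shows "density_of N \<in> borel_measurable S" "density_of N x < \<infinity>" "density \<kappa> (density_of N) = N"
proof -
  interpret finite_measure \<kappa>
    by (rule finite_kappa)
  let ?f = "RN_deriv \<kappa> N"
  define f where "f x = (if ?f x = \<infinity> then 0 else ?f x)" for x
  have sets': "sets N = sets \<kappa>"
    using sets by simp
  have [measurable]: "?f \<in> borel_measurable S"
    using borel_measurable_RN_deriv[of \<kappa> N] by simp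
  have meas: "f \<in> borel_measurable S"
    unfolding f_def[abs_def] by measurable
  have "AE x in \<kappa>. ?f x \<noteq> \<infinity>"
    using fin by (intro RN_deriv_finite ac sets' finite_measure.sigma_finite_measure)
  then have "density \<kappa> f = density \<kappa> ?f"
    using meas by (intro density_cong) (auto simp: f_def)
  then have "density \<kappa> f = N"
    using density_RN_deriv[OF ac sets'] by simp
  then have "\<exists>f. f \<in> borel_measurable S \<and> (\<forall>x. f x < \<infinity>) \<and> density \<kappa> f = N"
    using meas by (intro exI[of _ f]) (auto simp: f_def less_top)
  from someI_ex[OF this] show "density_of N \<in> borel_measurable S" "density_of N x < \<infinity>"
    "density \<kappa> (density_of N) = N"
    unfolding density_of_def[symmetric] by auto
qed

definition image_density :: "('a \<Rightarrow> ennreal) \<Rightarrow> 'a \<Rightarrow> ennreal" where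
  "image_density a = density_of (density \<mu> a \<bind> K)"

context
  fixes a :: "'a \<Rightarrow> ennreal"
  assumes a [measurable]: "a \<in> borel_measurable S" and a_le: "\<And>x. a x \<le> 1"
begin

lemma finite_density_a: "finite_measure (density \<mu> a)"
proof
  interpret finite_measure \<mu>
    by (rule fin_mu)
  have "emeasure (density \<mu> a) (space (density \<mu> a)) = (\<integral>\<^sup>+ x. a x \<partial>\<mu>)"
    by (subst emeasure_density) (auto intro!: nn_integral_cong)
  also have "\<dots> \<le> (\<integral>\<^sup>+ x. 1 \<partial>\<mu>)"
    by (intro nn_integral_mono a_le)
  also have "\<dots> < \<infinity>"
    using emeasure_finite[of "space \<mu>"] by (simp add: less_top[symmetric])
  finally show "emeasure (density \<mu> a) (space (density \<mu> a)) \<noteq> \<infinity>"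
    by simp
qed

lemma image_absolutely_continuous: "absolutely_continuous \<kappa> (density \<mu> a \<bind> K)"
  unfolding absolutely_continuous_def
proof
  fix A assume "A \<in> null_sets \<kappa>"
  then have [measurable]: "A \<in> sets S" and 0: "emeasure \<kappa> A = 0"
    by auto
  have "emeasure (density \<mu> a \<bind> K) A = (\<integral>\<^sup>+ y. indicator A y \<partial>(density \<mu> a \<bind> K))"
    by (simp add: sets_bind_K sets_mu)
  also have "\<dots> = (\<integral>\<^sup>+ x. a x * avg (indicator A) x \<partial>\<mu>)"
    by (subst nn_integral_bind_K) (simp_all add: sets_mu nn_integral_density)
  also have "\<dots> \<le> (\<integral>\<^sup>+ x. 1 * avg (indicator A) x \<partial>\<mu>)"
    by (intro nn_integral_mono mult_right_mono a_le) simp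
  also have "\<dots> = 0"
    using 0 nn_integral_kappa[of "indicator A"] by simp
  finally show "A \<in> null_sets (density \<mu> a \<bind> K)"
    by (simp add: null_sets_def sets_bind_K sets_mu)
qed

lemma image_density_measurable [measurable]: "image_density a \<in> borel_measurable S"
  and image_density_finite: "image_density a x < \<infinity>"
  and density_image_density: "density \<kappa> (image_density a) = density \<mu> a \<bind> K"
  unfolding image_density_def
  using density_of[OF finite_bind_K[OF finite_density_a] image_absolutely_continuous]
  by (simp_all add: sets_bind_K sets_mu)

lemma nn_integral_image_density:
  assumes [measurable]: "\<phi> \<in> borel_measurable S"
  shows "(\<integral>\<^sup>+ x. a x * avg \<phi> x \<partial>\<mu>) = (\<integral>\<^sup>+ y. image_density a y * \<phi> y \<partial>\<kappa>)"
proof -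
  have "(\<integral>\<^sup>+ x. a x * avg \<phi> x \<partial>\<mu>) = (\<integral>\<^sup>+ y. \<phi> y \<partial>(density \<mu> a \<bind> K))"
    by (subst nn_integral_bind_K) (simp_all add: sets_mu nn_integral_density)
  also have "\<dots> = (\<integral>\<^sup>+ y. image_density a y * \<phi> y \<partial>\<kappa>)"
    unfolding density_image_density[symmetric] by (rule nn_integral_density) measurable
  finally show ?thesis .
qed

end

text \<open>
  The image of \<open>a' \<mu>\<close> is the sum of the images of \<open>a \<mu>\<close> and \<open>(a' - a) \<mu>\<close>, and densities are unique
  almost everywhere.
\<close>
lemma image_density_mono:
  assumes [measurable]: "a \<in> borel_measurable S" "a' \<in> borel_measurable S"
    and le: "\<And>x. a x \<le> a' x" "\<And>x. a' x \<le> 1"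
  shows "AE y in \<kappa>. image_density a y \<le> image_density a' y"
proof -
  interpret finite_measure \<kappa>
    by (rule finite_kappa)
  let ?d = "\<lambda>x. a' x - a x"
  have a1: "a x \<le> 1" and d1: "?d x \<le> 1" for x
    using le order_trans diff_le_self_ennreal by blast+
  have d [measurable]: "?d \<in> borel_measurable S"
    by measurable
  note [measurable] = image_density_measurable[OF assms(1) a1]
    image_density_measurable[OF assms(2) le(2)] image_density_measurable[OF d d1]
  have "AE y in \<kappa>. image_density a y + image_density ?d y = image_density a' y"
  proof (rule density_unique_finite_measure)
    fix A assume "A \<in> sets \<kappa>"
    then have [measurable]: "A \<in> sets S"
      by simp
    have "(\<integral>\<^sup>+ y. (image_density a y + image_density ?d y) * indicator A y \<partial>\<kappa>) =
        (\<integral>\<^sup>+ x. a x * avg (indicator A) x \<partial>\<mu>) + (\<integral>\<^sup>+ x. ?d x * avg (indicator A) x \<partial>\<mu>)"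
      by (simp add: nn_integral_image_density a1 d1 distrib_right nn_integral_add)
    also have "\<dots> = (\<integral>\<^sup>+ x. a' x * avg (indicator A) x \<partial>\<mu>)"
      using le(1) by (simp add: nn_integral_add[symmetric] distrib_right[symmetric]
          add_diff_inverse_ennreal)
    finally show "(\<integral>\<^sup>+ y. (image_density a y + image_density ?d y) * indicator A y \<partial>\<kappa>) =
        (\<integral>\<^sup>+ y. image_density a' y * indicator A y \<partial>\<kappa>)"
      by (simp add: nn_integral_image_density le)
  qed auto
  then show ?thesis
    by eventually_elim (rule ennreal_summand_le)
qed

section \<open>The greedy transport\<close>

text \<open>
  The pair consists of the density with respect to \<open>\<mu>\<close> of the mass that is still unused and the density
  with respect to \<open>\<kappa>\<close> of the part of \<open>\<nu>\<close> that is still missing. At \<open>y\<close>, the mass \<open>m y\<close> is accepted out of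
  the mass that arrives; hence the fraction \<open>avg (\<lambda>y. m y / image_density a y) x\<close> of the mass at \<open>x\<close> is
  used up. Where no mass arrives, the quotient is \<open>0 / 0 = 0\<close>.
\<close>
primrec residual :: "nat \<Rightarrow> ('a \<Rightarrow> ennreal) \<times> ('a \<Rightarrow> ennreal)" where
  "residual 0 = (\<lambda>_. 1, density_of \<nu>)"
| "residual (Suc n) =
    (let a = fst (residual n); g = snd (residual n); m = (\<lambda>y. min (image_density a y) (g y))
     in (\<lambda>x. a x * (1 - avg (\<lambda>y. m y / image_density a y) x), \<lambda>y. g y - m y))"

definition stock :: "nat \<Rightarrow> 'a \<Rightarrow> ennreal" where "stock n = fst (residual n)"
definition demand :: "nat \<Rightarrow> 'a \<Rightarrow> ennreal" where "demand n = snd (residual n)"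

definition served :: "nat \<Rightarrow> 'a \<Rightarrow> ennreal" where
  "served n y = min (image_density (stock n) y) (demand n y)"

definition acceptance :: "nat \<Rightarrow> 'a \<Rightarrow> ennreal" where
  "acceptance n y = served n y / image_density (stock n) y"

lemma stock_0 [simp]: "stock 0 x = 1" and demand_0 [simp]: "demand 0 = density_of \<nu>"
  by (simp_all add: stock_def demand_def)

lemma stock_Suc: "stock (Suc n) x = stock n x * (1 - avg (acceptance n) x)"
  by (simp add: stock_def demand_def served_def[abs_def] acceptance_def[abs_def] Let_def)

lemma demand_Suc: "demand (Suc n) y = demand n y - served n y"
  by (simp add: stock_def demand_def served_def Let_def)

lemma stock_Suc_le: "stock (Suc n) x \<le> stock n x"
  unfolding stock_Suc by (rule mult_left_le) (simp_all add: diff_le_self_ennreal)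

lemma stock_le_1: "stock n x \<le> 1"
  by (induction n) (auto intro: order_trans[OF stock_Suc_le])

lemma density_nu:
  "density_of \<nu> \<in> borel_measurable S" "density_of \<nu> y < \<infinity>" "density \<kappa> (density_of \<nu>) = \<nu>"
  by (rule density_of[OF fin_nu nu_absolutely_continuous sets_nu])+

lemma measurable_stock_demand: "stock n \<in> borel_measurable S \<and> demand n \<in> borel_measurable S"
proof (induction n)
  case 0
  have "stock 0 = (\<lambda>_. 1)"
    by (rule ext) simp
  then show ?case
    using density_nu(1) by simp
next
  case (Suc n)
  then have [measurable]: "stock n \<in> borel_measurable S" "demand n \<in> borel_measurable S"
    by auto
  have [measurable]: "image_density (stock n) \<in> borel_measurable S"
    by (rule image_density_measurable) (simp_all add: stock_le_1)
  have [measurable]: "served n \<in> borel_measurable S"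
    unfolding served_def[abs_def] by measurable
  have [measurable]: "acceptance n \<in> borel_measurable S"
    unfolding acceptance_def[abs_def] by measurable
  show ?case
    unfolding stock_Suc[abs_def] demand_Suc[abs_def] by measurable
qed

lemma measurable_stock [measurable]: "stock n \<in> borel_measurable S"
  and measurable_demand [measurable]: "demand n \<in> borel_measurable S"
  using measurable_stock_demand by auto

lemma measurable_image_stock [measurable]: "image_density (stock n) \<in> borel_measurable S"
  by (rule image_density_measurable) (simp_all add: stock_le_1)

lemma measurable_served [measurable]: "served n \<in> borel_measurable S"
  unfolding served_def[abs_def] by measurable

lemma measurable_acceptance [measurable]: "acceptance n \<in> borel_measurable S"
  unfolding acceptance_def[abs_def] by measurable

lemma image_stock_finite: "image_density (stock n) y < \<infinity>"
  by (rule image_density_finite) (simp_all add: stock_le_1)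

lemma acceptance_le_1: "acceptance n y \<le> 1"
proof -
  have "acceptance n y \<le> image_density (stock n) y / image_density (stock n) y"
    unfolding acceptance_def served_def by (rule divide_right_mono_ennreal) simp
  also have "\<dots> \<le> 1"
    using image_stock_finite[of n y] by (cases "image_density (stock n) y = 0") auto
  finally show ?thesis .
qed

lemma image_times_acceptance: "image_density (stock n) y * acceptance n y = served n y"
proof (cases "image_density (stock n) y = 0")
  case True
  then show ?thesis
    by (simp add: served_def)
next
  case False
  then show ?thesis
    using image_stock_finite[of n y]
    by (simp add: acceptance_def ennreal_times_divide mult_divide_eq_ennreal mult.commute less_top)
qed

text \<open>
  The mass that leaves in a round and is accepted is the mass by which the demand falls, also when both
  are tested against a function of the destination.
\<close>
lemma flow_eq_served:
  assumes [measurable]: "\<phi> \<in> borel_measurable S"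
  shows "(\<integral>\<^sup>+ x. stock n x * avg (\<lambda>y. acceptance n y * \<phi> y) x \<partial>\<mu>) = (\<integral>\<^sup>+ y. served n y * \<phi> y \<partial>\<kappa>)"
  by (subst nn_integral_image_density) (simp_all add: stock_le_1 image_times_acceptance[symmetric] mult.assoc)

lemma stock_split:
  assumes "x \<in> space S"
  shows "stock n x * avg (acceptance n) x + stock (Suc n) x = stock n x"
proof -
  have "stock n x * avg (acceptance n) x + stock (Suc n) x = stock n x * (avg (acceptance n) x + (1 - avg (acceptance n) x))"
    by (simp add: stock_Suc distrib_left)
  also have "avg (acceptance n) x + (1 - avg (acceptance n) x) = 1"
    by (intro add_diff_inverse_ennreal avg_le_1 assms acceptance_le_1)
  finally show ?thesis
    by simp
qed

lemma demand_split: "served n y + demand (Suc n) y = demand n y"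
  unfolding demand_Suc by (rule add_diff_inverse_ennreal) (simp add: served_def)

definition unused_stock :: "'a \<Rightarrow> ennreal" where "unused_stock x = (INF n. stock n x)"
definition unmet_demand :: "'a \<Rightarrow> ennreal" where "unmet_demand y = (INF n. demand n y)"

lemma measurable_limits [measurable]:
  "unused_stock \<in> borel_measurable S" "unmet_demand \<in> borel_measurable S"
  unfolding unused_stock_def[abs_def] unmet_demand_def[abs_def] by measurable

lemma unused_stock_le: "unused_stock x \<le> stock n x" and unmet_demand_le: "unmet_demand y \<le> demand n y"
  unfolding unused_stock_def unmet_demand_def by (auto intro: INF_lower)

lemma stock_total: "x \<in> space S \<Longrightarrow> (\<Sum>n. stock n x * avg (acceptance n) x) + unused_stock x = 1"
  unfolding unused_stock_def using suminf_plus_INF[of "\<lambda>n. stock n x * avg (acceptance n) x" "\<lambda>n. stock n x"]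
  by (simp add: stock_split)

lemma demand_total: "(\<Sum>n. served n y) + unmet_demand y = density_of \<nu> y"
  unfolding unmet_demand_def using suminf_plus_INF[of "\<lambda>n. served n y" "\<lambda>n. demand n y"]
  by (simp add: demand_split)

lemma nu_total:
  assumes [measurable]: "A \<in> sets S"
  shows "(\<Sum>n. \<integral>\<^sup>+ x. stock n x * avg (\<lambda>y. acceptance n y * indicator A y) x \<partial>\<mu>) +
    (\<integral>\<^sup>+ y. unmet_demand y * indicator A y \<partial>\<kappa>) = emeasure \<nu> A"
proof -
  note [measurable] = density_nu(1)
  have "emeasure \<nu> A = (\<integral>\<^sup>+ y. density_of \<nu> y * indicator A y \<partial>\<kappa>)"
    by (subst density_nu(3)[symmetric]) (simp add: emeasure_density)
  also have "\<dots> = (\<integral>\<^sup>+ y. (\<Sum>n. served n y * indicator A y) + unmet_demand y * indicator A y \<partial>\<kappa>)"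
    by (simp add: demand_total[symmetric] distrib_right)
  also have "\<dots> = (\<Sum>n. \<integral>\<^sup>+ y. served n y * indicator A y \<partial>\<kappa>) +
      (\<integral>\<^sup>+ y. unmet_demand y * indicator A y \<partial>\<kappa>)"
    by (subst nn_integral_add) (simp_all add: nn_integral_suminf del: ennreal_suminf_multc)
  finally show ?thesis
    by (simp add: flow_eq_served)
qed

lemma mu_total:
  assumes C: "invariant C"
  shows "(\<Sum>n. \<integral>\<^sup>+ x. stock n x * avg (\<lambda>y. acceptance n y * indicator C y) x \<partial>\<mu>) +
    (\<integral>\<^sup>+ x. unused_stock x * indicator C x \<partial>\<mu>) = emeasure \<mu> C"
proof -
  have [measurable]: "C \<in> sets S"
    using C by (simp add: invariant_def)
  have "emeasure \<mu> C = (\<integral>\<^sup>+ x. indicator C x \<partial>\<mu>)"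
    by (simp add: sets_mu)
  also have "\<dots> = (\<integral>\<^sup>+ x. (\<Sum>n. stock n x * avg (acceptance n) x * indicator C x) +
      unused_stock x * indicator C x \<partial>\<mu>)"
    by (intro nn_integral_cong) (simp add: distrib_right[symmetric] stock_total)
  also have "\<dots> = (\<Sum>n. \<integral>\<^sup>+ x. stock n x * avg (acceptance n) x * indicator C x \<partial>\<mu>) +
      (\<integral>\<^sup>+ x. unused_stock x * indicator C x \<partial>\<mu>)"
    by (subst nn_integral_add) (simp_all add: nn_integral_suminf del: ennreal_suminf_multc)
  also have "(\<lambda>n. \<integral>\<^sup>+ x. stock n x * avg (acceptance n) x * indicator C x \<partial>\<mu>) =
      (\<lambda>n. \<integral>\<^sup>+ x. stock n x * avg (\<lambda>y. acceptance n y * indicator C y) x \<partial>\<mu>)"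
    by (intro ext nn_integral_cong) (simp add: avg_indicator_invariant[OF C] mult.assoc)
  finally show ?thesis
    by simp
qed

text \<open>
  Mass that starts in an invariant set arrives there. So every round removes equal amounts from the stock
  and from the demand in this set, and these were equal at first.
\<close>
lemma leftovers_agree:
  assumes C: "invariant C"
  shows "(\<integral>\<^sup>+ x. unused_stock x * indicator C x \<partial>\<mu>) = (\<integral>\<^sup>+ y. unmet_demand y * indicator C y \<partial>\<kappa>)"
proof -
  interpret finite_measure \<mu>
    by (rule fin_mu)
  have "C \<in> sets S"
    using C by (simp add: invariant_def)
  let ?s = "\<Sum>n. \<integral>\<^sup>+ x. stock n x * avg (\<lambda>y. acceptance n y * indicator C y) x \<partial>\<mu>"
  have eq: "?s + (\<integral>\<^sup>+ x. unused_stock x * indicator C x \<partial>\<mu>) =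
      ?s + (\<integral>\<^sup>+ y. unmet_demand y * indicator C y \<partial>\<kappa>)"
    using mu_total[OF C] nu_total[OF \<open>C \<in> sets S\<close>] agree[OF C] by simp
  have "?s \<le> emeasure \<mu> C"
    by (rule ennreal_summand_le[OF mu_total[OF C]])
  also have "\<dots> < \<infinity>"
    by (simp add: less_top[symmetric])
  finally show ?thesis
    using eq by (auto simp: ennreal_add_left_cancel)
qed

text \<open>
  If the mass arriving from the unused stock had a common part with the unmet demand, every round would
  have served at least this part, and the total amount served would be infinite.
\<close>
lemma leftovers_singular: "AE y in \<kappa>. min (image_density unused_stock y) (unmet_demand y) = 0"
proof -
  interpret nu: finite_measure \<nu>
    by (rule fin_nu)
  have unused_le_1: "unused_stock x \<le> 1" for x
    using unused_stock_le[of x 0] by simp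
  note [measurable] = image_density_measurable[OF measurable_limits(1) unused_le_1]
  define c where "c = (\<integral>\<^sup>+ y. min (image_density unused_stock y) (unmet_demand y) \<partial>\<kappa>)"
  \<comment> \<open>The unused stock is below the stock of each round, and so is the density of its image.\<close>
  have c_le: "c \<le> (\<integral>\<^sup>+ y. served n y \<partial>\<kappa>)" for n
    unfolding c_def
  proof (rule nn_integral_mono_AE)
    have "AE y in \<kappa>. image_density unused_stock y \<le> image_density (stock n) y"
      by (rule image_density_mono) (simp_all add: unused_stock_le stock_le_1)
    then show "AE y in \<kappa>. min (image_density unused_stock y) (unmet_demand y) \<le> served n y"
      by eventually_elim (unfold served_def, rule min.mono[OF _ unmet_demand_le])
  qed
  have "of_nat n * c \<le> emeasure \<nu> (space S)" for n
  proof -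
    have "of_nat n * c = (\<Sum>i<n. c)"
      by simp
    also have "\<dots> \<le> (\<Sum>i<n. \<integral>\<^sup>+ y. served i y \<partial>\<kappa>)"
      by (intro sum_mono c_le)
    also have "\<dots> \<le> (\<Sum>i. \<integral>\<^sup>+ y. served i y \<partial>\<kappa>)"
      by (rule sum_le_suminf) (simp_all add: summableI)
    also have "(\<lambda>i. \<integral>\<^sup>+ y. served i y \<partial>\<kappa>) = (\<lambda>i. \<integral>\<^sup>+ y. served i y * indicator (space S) y \<partial>\<kappa>)"
      by (rule ext, rule nn_integral_cong) simp
    also have "(\<Sum>i. \<integral>\<^sup>+ y. served i y * indicator (space S) y \<partial>\<kappa>) \<le> emeasure \<nu> (space S)"
      using ennreal_summand_le[OF nu_total[OF sets.top]] unfolding flow_eq_served[OF borel_measurable_indicator[OF sets.top]] .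
    finally show ?thesis .
  qed
  moreover have "emeasure \<nu> (space S) < \<infinity>"
    by (simp add: less_top[symmetric])
  ultimately have "c = 0"
    by (rule bounded_multiples_zero)
  moreover have "(\<lambda>y. min (image_density unused_stock y) (unmet_demand y)) \<in> borel_measurable \<kappa>"
    by measurable
  ultimately show ?thesis
    unfolding c_def using nn_integral_0_iff_AE by blast
qed

text \<open>
  The unused stock does not reach the set \<open>A\<close> of unmet demand, hence vanishes on the saturation of \<open>A\<close>. By
  \<open>leftovers_agree\<close> the unmet demand vanishes on this saturation, which contains \<open>A\<close>.
\<close>
lemma no_leftovers:
  shows "(\<integral>\<^sup>+ y. unmet_demand y \<partial>\<kappa>) = 0" "(\<integral>\<^sup>+ x. unused_stock x \<partial>\<mu>) = 0"
proof -
  have unused_le_1: "unused_stock x \<le> 1" for x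
    using unused_stock_le[of x 0] by simp
  note [measurable] = image_density_measurable[OF measurable_limits(1) unused_le_1]
  define A where "A = {y \<in> space S. unmet_demand y \<noteq> 0}"
  have A [measurable]: "A \<in> sets S"
    unfolding A_def by measurable
  have [measurable]: "saturation A \<in> sets S"
    using invariant_saturation[OF A] by (simp add: invariant_def)
  have "(\<integral>\<^sup>+ x. unused_stock x * avg (indicator A) x \<partial>\<mu>) =
      (\<integral>\<^sup>+ y. image_density unused_stock y * indicator A y \<partial>\<kappa>)"
    by (rule nn_integral_image_density) (simp_all add: unused_le_1)
  also have "\<dots> = (\<integral>\<^sup>+ y. 0 \<partial>\<kappa>)"
    using leftovers_singular
    by (intro nn_integral_cong_AE, eventually_elim) (simp add: A_def indicator_def min_def split: if_splits)
  finally have "(\<integral>\<^sup>+ x. unused_stock x * avg (indicator A) x \<partial>\<mu>) = 0"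
    by simp
  then have "AE x in \<mu>. unused_stock x * avg (indicator A) x = 0"
    by (subst (asm) nn_integral_0_iff_AE) simp_all
  then have "AE x in \<mu>. unused_stock x * indicator (saturation A) x = 0"
  proof (rule AE_mp, intro AE_I2 impI)
    fix x assume "x \<in> space \<mu>" "unused_stock x * avg (indicator A) x = 0"
    then show "unused_stock x * indicator (saturation A) x = 0"
      by (cases "x \<in> saturation A") (simp_all add: saturation_def avg_indicator)
  qed
  then have "(\<integral>\<^sup>+ x. unused_stock x * indicator (saturation A) x \<partial>\<mu>) = 0"
    by (subst nn_integral_0_iff_AE) simp_all
  then have 0: "(\<integral>\<^sup>+ y. unmet_demand y * indicator (saturation A) y \<partial>\<kappa>) = 0"
    by (simp add: leftovers_agree[OF invariant_saturation[OF A]])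
  have "unmet_demand y = unmet_demand y * indicator (saturation A) y" if "y \<in> space S" for y
  proof (cases "y \<in> saturation A")
    case False
    then have "y \<notin> A"
      using saturation_superset[OF A] by blast
    with that False show ?thesis
      by (simp add: A_def)
  qed simp
  then have "(\<integral>\<^sup>+ y. unmet_demand y \<partial>\<kappa>) = (\<integral>\<^sup>+ y. unmet_demand y * indicator (saturation A) y \<partial>\<kappa>)"
    by (intro nn_integral_cong) simp
  with 0 show demand_met: "(\<integral>\<^sup>+ y. unmet_demand y \<partial>\<kappa>) = 0"
    by simp
  have "invariant (space S)"
    by (simp add: invariant_def)
  note leftovers_agree[OF this]
  moreover have "(\<integral>\<^sup>+ x. unused_stock x * indicator (space S) x \<partial>\<mu>) = (\<integral>\<^sup>+ x. unused_stock x \<partial>\<mu>)"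
    and "(\<integral>\<^sup>+ y. unmet_demand y * indicator (space S) y \<partial>\<kappa>) = (\<integral>\<^sup>+ y. unmet_demand y \<partial>\<kappa>)"
    by (intro nn_integral_cong; simp)+
  ultimately show "(\<integral>\<^sup>+ x. unused_stock x \<partial>\<mu>) = 0"
    using demand_met by simp
qed

text \<open>
  The summand of index \<open>n\<close> is the transport of round \<open>n\<close>. Its form, a function of the origin times \<open>K\<close> times
  a function of the destination, keeps the whole transport inside the classes and makes it jointly
  measurable.
\<close>
theorem transport_exists:
  obtains a b :: "nat \<Rightarrow> 'a \<Rightarrow> ennreal"
  where "\<And>n. a n \<in> borel_measurable S" "\<And>n. b n \<in> borel_measurable S"
    and "\<And>x. x \<in> space S \<Longrightarrow> (\<Sum>n. a n x * (\<integral>\<^sup>+ y. b n y \<partial>K x)) \<le> 1"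
    and "AE x in \<mu>. (\<Sum>n. a n x * (\<integral>\<^sup>+ y. b n y \<partial>K x)) = 1"
    and "\<And>A. A \<in> sets S \<Longrightarrow>
      emeasure \<nu> A = (\<Sum>n. \<integral>\<^sup>+ x. a n x * (\<integral>\<^sup>+ y. b n y * indicator A y \<partial>K x) \<partial>\<mu>)"
proof
  show "stock n \<in> borel_measurable S" for n
    by (rule measurable_stock)
  show "acceptance n \<in> borel_measurable S" for n
    by (rule measurable_acceptance)
  show "(\<Sum>n. stock n x * (\<integral>\<^sup>+ y. acceptance n y \<partial>K x)) \<le> 1" if "x \<in> space S" for x
    using ennreal_summand_le[OF stock_total[OF that]] unfolding avg_def .
  have "AE x in \<mu>. unused_stock x = 0"
    using no_leftovers(2) by (subst (asm) nn_integral_0_iff_AE) simp_all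
  then show "AE x in \<mu>. (\<Sum>n. stock n x * (\<integral>\<^sup>+ y. acceptance n y \<partial>K x)) = 1"
  proof (rule AE_mp, intro AE_I2 impI)
    fix x assume "x \<in> space \<mu>" "unused_stock x = 0"
    then show "(\<Sum>n. stock n x * (\<integral>\<^sup>+ y. acceptance n y \<partial>K x)) = 1"
      using stock_total[of x] by (simp add: avg_def)
  qed
  show "emeasure \<nu> A = (\<Sum>n. \<integral>\<^sup>+ x. stock n x * (\<integral>\<^sup>+ y. acceptance n y * indicator A y \<partial>K x) \<partial>\<mu>)"
    if [measurable]: "A \<in> sets S" for A
  proof -
    have "AE y in \<kappa>. unmet_demand y = 0"
      using no_leftovers(1) by (subst (asm) nn_integral_0_iff_AE) simp_all
    then have "AE y in \<kappa>. unmet_demand y * indicator A y = 0"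
      by eventually_elim simp
    then have "(\<integral>\<^sup>+ y. unmet_demand y * indicator A y \<partial>\<kappa>) = 0"
      by (subst nn_integral_0_iff_AE) simp_all
    then show ?thesis
      using nu_total[OF that] by (simp add: avg_def)
  qed
qed

end

section \<open>Isomorphisms of balls\<close>

lemma relpow_gdist:
  assumes "is_network G" "u \<in> verts G" "v \<in> verts G"
  shows "(u, v) \<in> adj G ^^ gdist G u v"
proof -
  have "(u, v) \<in> (adj G)\<^sup>*"
    using assms by (simp add: is_network_def)
  then obtain k where "(u, v) \<in> adj G ^^ k"
    using rtrancl_imp_relpow by blast
  then show ?thesis
    unfolding gdist_def by (rule LeastI)
qed

lemma gdist_le: "(u, v) \<in> adj G ^^ k \<Longrightarrow> gdist G u v \<le> k"
  unfolding gdist_def by (rule Least_le)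

text \<open>
  A path of length \<open>k\<close> from \<open>v\<close> leaves the ball about \<open>u\<close> only if the distance of \<open>v\<close> from \<open>u\<close> plus \<open>k\<close> exceeds
  the radius. This is why a ball isomorphism controls distances between some of its points, although
  an induced subgraph need not carry the distances of the whole graph.
\<close>
lemma relpow_in_ball:
  assumes G: "is_network G" "u \<in> verts G" "v \<in> verts G"
    and r: "gdist G u v + k \<le> r" and path: "(v, w) \<in> adj G ^^ k"
  shows "w \<in> verts G \<and> gdist G u w \<le> gdist G u v + k \<and> (v, w) \<in> adj (net_ball G u r) ^^ k"
  using r path
proof (induction k arbitrary: w)
  case 0
  then show ?case
    using G by simp
next
  case (Suc k)
  from Suc.prems(2) obtain w' where w': "(v, w') \<in> adj G ^^ k" "(w', w) \<in> adj G"
    by (rule relpow_Suc_E)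
  with Suc have IH: "w' \<in> verts G" "gdist G u w' \<le> gdist G u v + k"
    "(v, w') \<in> adj (net_ball G u r) ^^ k"
    by auto
  from w'(2) obtain e where e: "e \<in> edges G" "ends G e = {w', w}"
    by (auto simp: adj_def)
  then have w: "w \<in> verts G"
    using is_network_ends[OF G(1) e(1)] by auto
  have "(u, w) \<in> adj G ^^ Suc (gdist G u w')"
    using relpow_gdist[OF G(1,2) IH(1)] w'(2) by (rule relpow_Suc_I)
  then have d: "gdist G u w \<le> gdist G u v + Suc k"
    using gdist_le IH(2) by fastforce
  then have "e \<in> edges (net_ball G u r)"
    using e w IH Suc.prems(1) by auto
  then have "(w', w) \<in> adj (net_ball G u r)"
    using e(2) by (auto simp: adj_def)
  then show ?case
    using relpow_Suc_I[OF IH(3)] w d by blast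
qed

lemma relpow_subset:
  fixes R S :: "('a \<times> 'a) set"
  assumes "R \<subseteq> S"
  shows "(x, y) \<in> R ^^ k \<Longrightarrow> (x, y) \<in> S ^^ k"
  using assms by (induction k arbitrary: y) auto

lemma gdist_triangle:
  assumes "is_network G" "u \<in> verts G" "v \<in> verts G" "w \<in> verts G"
  shows "gdist G u w \<le> gdist G u v + gdist G v w"
  using relpow_in_ball[OF assms(1-3) order_refl relpow_gdist[OF assms(1,3,4)]] by simp

text \<open>
  The relation \<open>P\<close> between marks is kept arbitrary, so that exact isomorphisms, approximate ones and their
  inverses are all instances.
\<close>
locale ball_iso =
  fixes P :: "'x \<Rightarrow> 'x \<Rightarrow> bool" and G H :: "'x network" and u u' r :: nat and f g :: "nat \<Rightarrow> nat"
  assumes G: "is_network G" "u \<in> verts G" and H: "is_network H" "u' \<in> verts H"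
    and iso: "net_iso P (net_ball G u r) (net_ball H u' r) f g" and root: "f u = u'"
begin

lemma gdist_image_le:
  assumes "v \<in> verts G" "w \<in> verts G" "gdist G u v + gdist G v w \<le> r"
  shows "gdist H (f v) (f w) \<le> gdist G v w"
proof (rule gdist_le)
  have "(v, w) \<in> adj (net_ball G u r) ^^ gdist G v w"
    using relpow_in_ball[OF G assms(1,3) relpow_gdist[OF G(1) assms(1,2)]] by simp
  then have "(f v, f w) \<in> adj (net_ball H u' r) ^^ gdist G v w"
    by (rule adj_relpow_map[OF iso])
  moreover have "adj (net_ball H u' r) \<subseteq> adj H"
    unfolding adj_def net_ball_simps by blast
  ultimately show "(f v, f w) \<in> adj H ^^ gdist G v w"
    by (rule relpow_subset[rotated])
qed

definition inv_f :: "nat \<Rightarrow> nat" where "inv_f = inv_into (verts (net_ball G u r)) f"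

lemma image_in_ball: "v \<in> verts (net_ball G u r) \<Longrightarrow> f v \<in> verts (net_ball H u' r)"
  by (rule net_isoD(8)[OF iso])

lemma inv_f_f: "v \<in> verts (net_ball G u r) \<Longrightarrow> inv_f (f v) = v"
  unfolding inv_f_def by (rule inv_into_f_f[OF net_isoD(1)[OF iso]])

lemma f_inv_f: "w \<in> verts (net_ball H u' r) \<Longrightarrow> f (inv_f w) = w"
  unfolding inv_f_def using net_isoD(2)[OF iso] by (metis f_inv_into_f)

lemma inverse: "ball_iso (\<lambda>a b. P b a) H G u' u r inv_f (inv_into (edges (net_ball G u r)) g)"
proof
  show "net_iso (\<lambda>a b. P b a) (net_ball H u' r) (net_ball G u r) inv_f
      (inv_into (edges (net_ball G u r)) g)"
    unfolding inv_f_def by (rule net_iso_inv[OF iso]) auto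
  show "inv_f u' = u"
    using inv_f_f[of u] G by (simp add: root)
qed (fact G H)+

lemma gdist_root_image:
  assumes "v \<in> verts G" "gdist G u v \<le> r"
  shows "gdist H u' (f v) = gdist G u v"
proof (rule antisym)
  interpret inv: ball_iso "\<lambda>a b. P b a" H G u' u r inv_f "inv_into (edges (net_ball G u r)) g"
    by (rule inverse)
  have v: "v \<in> verts (net_ball G u r)"
    using assms by simp
  show "gdist H u' (f v) \<le> gdist G u v"
    using gdist_image_le[of u v] G assms by (simp add: root)
  show "gdist G u v \<le> gdist H u' (f v)"
    using inv.gdist_image_le[of u' "f v"] H image_in_ball[OF v] inv_f_f[OF v]
    by (simp add: inv.root)
qed

context
  fixes v s
  assumes v: "v \<in> verts G" and s: "gdist G u v + s \<le> r"
begin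

lemma sub_ball_subset: "verts (net_ball G v s) \<subseteq> verts (net_ball G u r)"
proof
  fix w assume "w \<in> verts (net_ball G v s)"
  then have "w \<in> verts G" "gdist G v w \<le> s"
    by auto
  then show "w \<in> verts (net_ball G u r)"
    using gdist_triangle[OF G v \<open>w \<in> verts G\<close>] s by simp
qed

lemma v_in_ball: "v \<in> verts (net_ball G u r)"
  using v s by simp

lemma image_sub_ball: "f ` verts (net_ball G v s) \<subseteq> verts (net_ball H (f v) s)"
proof
  fix y assume "y \<in> f ` verts (net_ball G v s)"
  then obtain w where w: "w \<in> verts (net_ball G v s)" "y = f w"
    by blast
  then have "gdist H (f v) (f w) \<le> gdist G v w"
    using s v by (intro gdist_image_le) auto
  then show "y \<in> verts (net_ball H (f v) s)"
    using w image_in_ball[of w] sub_ball_subset by auto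
qed

end

text \<open>
  One inclusion is \<open>image_sub_ball\<close>, the other one is its instance for the inverse isomorphism.
\<close>
lemma sub_ball_image_eq:
  assumes v: "v \<in> verts G" and s: "gdist G u v + s \<le> r"
  shows "f ` verts (net_ball G v s) = verts (net_ball H (f v) s)"
proof
  show "f ` verts (net_ball G v s) \<subseteq> verts (net_ball H (f v) s)"
    by (rule image_sub_ball[OF assms])
  interpret inv: ball_iso "\<lambda>a b. P b a" H G u' u r inv_f "inv_into (edges (net_ball G u r)) g"
    by (rule inverse)
  have fv: "f v \<in> verts H" "gdist H u' (f v) + s \<le> r"
    using image_in_ball[OF v_in_ball[OF assms]] gdist_root_image[OF v] s by auto
  show "verts (net_ball H (f v) s) \<subseteq> f ` verts (net_ball G v s)"
  proof
    fix w assume w: "w \<in> verts (net_ball H (f v) s)"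
    then have "inv_f w \<in> verts (net_ball G v s)"
      using inv.image_sub_ball[OF fv] inv_f_f[OF v_in_ball[OF assms]] by auto
    moreover have "f (inv_f w) = w"
      using w inv.sub_ball_subset[OF fv] by (intro f_inv_f) auto
    ultimately show "w \<in> f ` verts (net_ball G v s)"
      by (metis imageI)
  qed
qed

text \<open>
  An isomorphism of balls about \<open>u\<close> restricts to smaller balls about another centre \<open>v\<close>, as long as these
  stay inside.
\<close>
lemma reroot:
  assumes v: "v \<in> verts G" and s: "gdist G u v + s \<le> r"
  shows "net_iso P (net_ball G v s) (net_ball H (f v) s) f g"
proof -
  interpret inv: ball_iso "\<lambda>a b. P b a" H G u' u r inv_f "inv_into (edges (net_ball G u r)) g"
    by (rule inverse)
  define A B where "A = verts (net_ball G v s)" and "B = verts (net_ball H (f v) s)"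
  note verts = this[symmetric]
  let ?EG = "{e \<in> edges G. ends G e \<subseteq> A}" and ?EH = "{e \<in> edges H. ends H e \<subseteq> B}"
  have fv: "f v \<in> verts H" "gdist H u' (f v) + s \<le> r"
    using image_in_ball[OF v_in_ball[OF assms]] gdist_root_image[OF v] s by auto
  have sub: "A \<subseteq> verts (net_ball G u r)" "B \<subseteq> verts (net_ball H u' r)"
    unfolding A_def B_def using sub_ball_subset[OF assms] inv.sub_ball_subset[OF fv] .
  have img: "f ` A = B"
    unfolding A_def B_def by (rule sub_ball_image_eq[OF assms])
  have sub_E: "?EG \<subseteq> edges (net_ball G u r)" "?EH \<subseteq> edges (net_ball H u' r)"
    using sub by auto
  have ends: "ends H (g e) = f ` ends G e" if "e \<in> edges (net_ball G u r)" for e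
    using net_isoD(5)[OF iso that] by simp
  have inj: "inj_on f (verts (net_ball G u r))"
    by (rule net_isoD(1)[OF iso])
  have "g ` ?EG = ?EH"
  proof
    show "g ` ?EG \<subseteq> ?EH"
    proof
      fix e' assume "e' \<in> g ` ?EG"
      then obtain e where e: "e \<in> ?EG" "e' = g e"
        by blast
      then have "e \<in> edges (net_ball G u r)"
        using sub_E by blast
      from ends[OF this] net_isoD(9)[OF iso this] show "e' \<in> ?EH"
        using e img by auto
    qed
    show "?EH \<subseteq> g ` ?EG"
    proof
      fix e' assume e': "e' \<in> ?EH"
      then obtain e where e: "e \<in> edges (net_ball G u r)" "e' = g e"
        using sub_E(2) net_isoD(4)[OF iso] by blast
      have "f ` ends G e \<subseteq> f ` A"
        using e' ends[OF e(1)] unfolding e(2) img by auto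
      moreover have "ends G e \<subseteq> verts (net_ball G u r)"
        using e(1) by auto
      ultimately have "ends G e \<subseteq> A"
        using inj_on_image_subset_iff[OF inj _ sub(1)] by blast
      then show "e' \<in> g ` ?EG"
        using e by auto
    qed
  qed
  then have "bij_betw g ?EG ?EH"
    using inj_on_subset[OF net_isoD(3)[OF iso] sub_E(1)] by (simp add: bij_betw_def)
  moreover have "bij_betw f A B"
    using inj_on_subset[OF inj sub(1)] img by (simp add: bij_betw_def)
  moreover have edges: "edges (net_ball G v s) = ?EG" "edges (net_ball H (f v) s) = ?EH"
    by (simp_all add: A_def B_def)
  moreover have "\<forall>w\<in>A. P (vmark G w) (vmark H (f w))"
    using net_isoD(6)[OF iso] sub(1) by auto
  moreover have "\<forall>e\<in>?EG. \<forall>w\<in>ends G e. P (emark G w e) (emark H (f w) (g e))"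
    using net_isoD(7)[OF iso] sub_E(1) by auto
  moreover have "\<forall>e\<in>?EG. ends H (g e) = f ` ends G e"
    using ends sub_E(1) by blast
  ultimately show ?thesis
    unfolding net_iso_def verts edges net_ball_simps(3-5) by blast
qed

end

section \<open>Neighbourhoods in the local topologies\<close>

lemma near_rooted_reroot:
  fixes G H :: "'x::metric_space network"
  assumes "ball_iso (\<lambda>a b. dist a b < \<delta>) G H u u' r f g"
    and "v \<in> verts G" "gdist G u v + s \<le> r" "\<delta> \<le> \<epsilon>"
  shows "near s \<epsilon> (rooted G v) (rooted H (f v))"
proof -
  interpret ball_iso "\<lambda>a b. dist a b < \<delta>" G H u u' r f g
    by fact
  have "net_iso (\<lambda>a b. dist a b < \<epsilon>) (net_ball G v s) (net_ball H (f v) s) f g"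
    by (rule net_iso_mono[OF reroot[OF assms(2,3)]]) (use assms(4) in simp)
  moreover have "f v \<in> verts H"
    using image_in_ball[OF v_in_ball[OF assms(2,3)]] by simp
  ultimately show ?thesis
    using G H assms(2) by (auto simp: near_rooted near_rep_def)
qed

lemma near_ball_iso:
  assumes "near r \<epsilon> (rooted G u) y" "is_network G" "u \<in> verts G"
  obtains H u' f g where "y = rooted H u'" "ball_iso (\<lambda>a b. dist a b < \<epsilon>) G H u u' r f g"
proof -
  obtain H u' where H: "is_network H" "u' \<in> verts H" "y = rooted H u'"
    by (rule rooted_exhaust)
  obtain f g where "net_iso (\<lambda>a b. dist a b < \<epsilon>) (net_ball G u r) (net_ball H u' r) f g" "f u = u'"
    using assms near_rooted[OF assms(2,3) H(1,2)] unfolding H(3) near_rep_def by auto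
  then show thesis
    using that[OF H(3)] assms H by (simp add: ball_iso_def)
qed

lemma doubly_near_ball_iso:
  assumes "doubly_near r \<epsilon> (doubly_rooted G u v) y" "is_network G" "u \<in> verts G" "v \<in> verts G"
  obtains H u' f g where "y = doubly_rooted H u' (f v)" "f v \<in> verts H"
    "ball_iso (\<lambda>a b. dist a b < \<epsilon>) G H u u' r f g"
proof -
  obtain H u' v' where H: "is_network H" "u' \<in> verts H" "v' \<in> verts H" "y = doubly_rooted H u' v'"
    by (rule doubly_rooted_exhaust)
  obtain f g where "net_iso (\<lambda>a b. dist a b < \<epsilon>) (net_ball G u r) (net_ball H u' r) f g"
    "f u = u'" "f v = v'"
    using assms doubly_near_doubly_rooted[OF assms(2-4) H(1-3)]
    unfolding H(4) doubly_near_rep_def by auto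
  then show thesis
    using that[of H u' f g] assms H by (simp add: ball_iso_def)
qed

lemma near_mono:
  assumes "near r' \<delta> x y" "r \<le> r'" "\<delta> \<le> \<epsilon>"
  shows "near r \<epsilon> x y"
proof -
  obtain G u where x: "is_network G" "u \<in> verts G" "x = rooted G u"
    by (rule rooted_exhaust)
  obtain H u' f g where y: "y = rooted H u'" and "ball_iso (\<lambda>a b. dist a b < \<delta>) G H u u' r' f g"
    using assms(1) x by (auto elim: near_ball_iso)
  from near_rooted_reroot[OF this(2) x(2) _ assms(3), of r] ball_iso.root[OF this(2)] show ?thesis
    using assms(2) by (simp add: x(3) y)
qed

text \<open>
  The topology is defined through convergent sequences. If no single neighbourhood of \<open>x\<close> of the form
  below were contained in \<open>U\<close>, points outside \<open>U\<close> in these neighbourhoods would converge to \<open>x\<close>.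
\<close>
lemma open_imp_near:
  fixes x :: "'x::metric_space rooted_network"
  assumes "open U" "x \<in> U"
  shows "\<exists>n. \<forall>y. near n (1 / Suc n) x y \<longrightarrow> y \<in> U"
proof (rule ccontr)
  assume "\<not> ?thesis"
  then obtain s where s: "\<And>n. near n (1 / Suc n) x (s n)" "\<And>n. s n \<notin> U"
    by metis
  have "local_limit s x"
    unfolding local_limit_def
  proof (intro allI impI)
    fix r and \<epsilon> :: real assume "\<epsilon> > 0"
    then obtain N where N: "1 / Suc N < \<epsilon>"
      using nat_approx_posE by blast
    have "near r \<epsilon> x (s n)" if "n \<ge> max r N" for n
    proof (rule near_mono[OF s(1)])
      have "1 / Suc n \<le> 1 / Suc N"
        using that by (intro divide_left_mono) auto
      then show "1 / Suc n \<le> \<epsilon>"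
        using N by simp
    qed (use that in simp)
    then show "\<forall>\<^sub>F n in sequentially. near r \<epsilon> x (s n)"
      unfolding eventually_sequentially by blast
  qed
  then have "\<forall>\<^sub>F n in sequentially. s n \<in> U"
    using assms unfolding open_rooted_network_def by blast
  then show False
    using s(2) by simp
qed

lemma openI_near:
  fixes U :: "'x::metric_space rooted_network set"
  assumes "\<And>x. x \<in> U \<Longrightarrow> \<exists>r. \<exists>\<epsilon>>0. \<forall>y. near r \<epsilon> x y \<longrightarrow> y \<in> U"
  shows "open U"
  unfolding open_rooted_network_def
proof (intro allI ballI impI)
  fix s x assume "x \<in> U" "local_limit s x"
  moreover from assms[OF this(1)] obtain r \<epsilon> where "\<epsilon> > 0" "\<forall>y. near r \<epsilon> x y \<longrightarrow> y \<in> U"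
    by blast
  ultimately show "\<forall>\<^sub>F n in sequentially. s n \<in> U"
    unfolding local_limit_def by (metis (mono_tags, lifting) eventually_mono)
qed

lemma openI_doubly_near:
  fixes U :: "'x::metric_space doubly_rooted_network set"
  assumes "\<And>x. x \<in> U \<Longrightarrow> \<exists>r\<ge>root_dist x. \<exists>\<epsilon>>0. \<forall>y. doubly_near r \<epsilon> x y \<longrightarrow> y \<in> U"
  shows "open U"
  unfolding open_doubly_rooted_network_def
proof (intro allI ballI impI)
  fix s x assume "x \<in> U" "doubly_local_limit s x"
  moreover from assms[OF this(1)] obtain r \<epsilon>
    where "r \<ge> root_dist x" "\<epsilon> > 0" "\<forall>y. doubly_near r \<epsilon> x y \<longrightarrow> y \<in> U"
    by blast
  ultimately show "\<forall>\<^sub>F n in sequentially. s n \<in> U"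
    unfolding doubly_local_limit_def by (metis (mono_tags, lifting) eventually_mono)
qed

section \<open>Borel measurability of the two roots\<close>

lift_definition first_root :: "'x doubly_rooted_network \<Rightarrow> 'x rooted_network"
  is "\<lambda>(G, u, v). (G, u)"
  by (auto simp: doubly_rooted_iso_def rooted_iso_def)

lift_definition second_root :: "'x doubly_rooted_network \<Rightarrow> 'x rooted_network"
  is "\<lambda>(G, u, v). (G, v)"
  by (auto simp: doubly_rooted_iso_def rooted_iso_def)

lemma roots_doubly_rooted:
  assumes "is_network G" "u \<in> verts G" "v \<in> verts G"
  shows "first_root (doubly_rooted G u v) = rooted G u"
    and "second_root (doubly_rooted G u v) = rooted G v"
  unfolding doubly_rooted_def rooted_def
  using first_root.abs_eq[OF doubly_rooted_iso_refl[OF assms]]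
    second_root.abs_eq[OF doubly_rooted_iso_refl[OF assms]] by simp_all

lemma measurable_open_vimage:
  assumes "\<And>U. open U \<Longrightarrow> open (h -` U)"
  shows "h \<in> borel \<rightarrow>\<^sub>M borel"
  using assms by (intro borel_measurableI) simp

lemma measurable_first_root [measurable]:
  "(first_root :: 'x::metric_space doubly_rooted_network \<Rightarrow> _) \<in> borel \<rightarrow>\<^sub>M borel"
proof (rule measurable_open_vimage, rule openI_doubly_near)
  fix U :: "'x rooted_network set" and x :: "'x doubly_rooted_network"
  assume U: "open U" and x: "x \<in> first_root -` U"
  obtain G u v where G: "is_network G" "u \<in> verts G" "v \<in> verts G" "x = doubly_rooted G u v"
    by (rule doubly_rooted_exhaust)
  obtain n where n: "\<And>y. near n (1 / Suc n) (rooted G u) y \<Longrightarrow> y \<in> U"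
    using open_imp_near[OF U, of "rooted G u"] x by (auto simp: G roots_doubly_rooted)
  have "y \<in> first_root -` U" if y: "doubly_near (root_dist x + n) (1 / Suc n) x y" for y
  proof -
    obtain H u' f g where H: "y = doubly_rooted H u' (f v)" "f v \<in> verts H"
      and iso: "ball_iso (\<lambda>a b. dist a b < 1 / Suc n) G H u u' (root_dist x + n) f g"
      using y G by (auto elim: doubly_near_ball_iso)
    have "near n (1 / Suc n) (rooted G u) (rooted H (f u))"
      by (rule near_rooted_reroot[OF iso G(2)]) simp_all
    then show ?thesis
      using n ball_iso.H[OF iso] ball_iso.root[OF iso] ball_iso.G[OF iso] H
      by (simp add: roots_doubly_rooted)
  qed
  then show "\<exists>r\<ge>root_dist x. \<exists>\<epsilon>>0. \<forall>y. doubly_near r \<epsilon> x y \<longrightarrow> y \<in> first_root -` U"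
    by (intro exI[of _ "root_dist x + n"] conjI exI[of _ "1 / Suc n"]) auto
qed

lemma measurable_second_root [measurable]:
  "(second_root :: 'x::metric_space doubly_rooted_network \<Rightarrow> _) \<in> borel \<rightarrow>\<^sub>M borel"
proof (rule measurable_open_vimage, rule openI_doubly_near)
  fix U :: "'x rooted_network set" and x :: "'x doubly_rooted_network"
  assume U: "open U" and x: "x \<in> second_root -` U"
  obtain G u v where G: "is_network G" "u \<in> verts G" "v \<in> verts G" "x = doubly_rooted G u v"
    by (rule doubly_rooted_exhaust)
  obtain n where n: "\<And>y. near n (1 / Suc n) (rooted G v) y \<Longrightarrow> y \<in> U"
    using open_imp_near[OF U, of "rooted G v"] x by (auto simp: G roots_doubly_rooted)
  have "y \<in> second_root -` U" if y: "doubly_near (root_dist x + n) (1 / Suc n) x y" for y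
  proof -
    obtain H u' f g where H: "y = doubly_rooted H u' (f v)" "f v \<in> verts H"
      and iso: "ball_iso (\<lambda>a b. dist a b < 1 / Suc n) G H u u' (root_dist x + n) f g"
      using y G by (auto elim: doubly_near_ball_iso)
    have "near n (1 / Suc n) (rooted G v) (rooted H (f v))"
      by (rule near_rooted_reroot[OF iso G(3)]) (simp_all add: G root_dist_doubly_rooted)
    then show ?thesis
      using n ball_iso.H[OF iso] H by (simp add: roots_doubly_rooted)
  qed
  then show "\<exists>r\<ge>root_dist x. \<exists>\<epsilon>>0. \<forall>y. doubly_near r \<epsilon> x y \<longrightarrow> y \<in> second_root -` U"
    by (intro exI[of _ "root_dist x + n"] conjI exI[of _ "1 / Suc n"]) auto
qed

section \<open>Spreading the root over its network\<close>

text \<open>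
  A vertex at distance \<open>d\<close> gets the fraction \<open>2\<^sup>-\<^sup>d\<^sup>-\<^sup>1\<close> of a unit mass, divided by the size of the ball of
  radius \<open>d\<close>. The weight depends only on the graph structure of a finite ball, so it is locally constant
  in the topology of doubly-rooted networks.
\<close>
definition net_spread :: "'x network \<Rightarrow> nat \<Rightarrow> nat \<Rightarrow> real" where
  "net_spread G u v = (1 / 2) ^ Suc (gdist G u v) / card (verts (net_ball G u (gdist G u v)))"

lemma (in ball_iso) net_spread_image:
  assumes "v \<in> verts G" "gdist G u v \<le> r"
  shows "net_spread H u' (f v) = net_spread G u v"
proof -
  have "net_iso P (net_ball G u (gdist G u v)) (net_ball H u' (gdist G u v)) f g"
    using reroot[of u "gdist G u v"] G assms by (simp add: root)
  then have "card (verts (net_ball G u (gdist G u v))) = card (verts (net_ball H u' (gdist G u v)))"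
    unfolding net_iso_def by (blast intro: bij_betw_same_card)
  then show ?thesis
    using gdist_root_image[OF assms] by (simp add: net_spread_def)
qed

lemma net_spread_pos:
  assumes "is_network G" "u \<in> verts G"
  shows "0 < net_spread G u v"
proof -
  have "u \<in> verts (net_ball G u (gdist G u v))"
    using assms by simp
  then have "0 < card (verts (net_ball G u (gdist G u v)))"
    using finite_net_ball(1)[OF assms] card_gt_0_iff by blast
  then show ?thesis
    unfolding net_spread_def by (intro divide_pos_pos) simp_all
qed

lift_definition spread :: "'x doubly_rooted_network \<Rightarrow> real"
  is "\<lambda>(G, u, v). net_spread G u v"
proof (clarsimp simp: doubly_rooted_iso_def)
  fix G H :: "'x network" and u v f g
  assume *: "is_network G" "is_network H" "u \<in> verts G" "v \<in> verts G" "f u \<in> verts H"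
    "net_iso (=) G H f g"
  interpret ball_iso "(=)" G H u "f u" "gdist G u v" f g
    using * by unfold_locales (auto intro: net_iso_ball)
  show "net_spread G u v = net_spread H (f u) (f v)"
    using net_spread_image[of v] * by simp
qed

lemma spread_doubly_rooted:
  assumes "is_network G" "u \<in> verts G" "v \<in> verts G"
  shows "spread (doubly_rooted G u v) = net_spread G u v"
  unfolding doubly_rooted_def using spread.abs_eq[OF doubly_rooted_iso_refl[OF assms]] by simp

lemma measurable_spread [measurable]:
  "(spread :: 'x::metric_space doubly_rooted_network \<Rightarrow> real) \<in> borel_measurable borel"
proof (rule measurable_open_vimage, rule openI_doubly_near)
  fix U :: "real set" and x :: "'x doubly_rooted_network"
  assume x: "x \<in> spread -` U"
  obtain G u v where G: "is_network G" "u \<in> verts G" "v \<in> verts G" "x = doubly_rooted G u v"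
    by (rule doubly_rooted_exhaust)
  have "spread y = spread x" if y: "doubly_near (root_dist x) 1 x y" for y
  proof -
    obtain H u' f g where H: "y = doubly_rooted H u' (f v)" "f v \<in> verts H"
      and iso: "ball_iso (\<lambda>a b. dist a b < 1) G H u u' (root_dist x) f g"
      using y G by (auto elim: doubly_near_ball_iso)
    show ?thesis
      using ball_iso.net_spread_image[OF iso G(3)] ball_iso.H[OF iso] H G
      by (simp add: spread_doubly_rooted root_dist_doubly_rooted)
  qed
  then show "\<exists>r\<ge>root_dist x. \<exists>\<epsilon>>0. \<forall>y. doubly_near r \<epsilon> x y \<longrightarrow> y \<in> spread -` U"
    using x by (intro exI[of _ "root_dist x"] conjI exI[of _ 1]) auto
qed

text \<open>
  For each \<open>d\<close>, spread the mass \<open>2\<^sup>-\<^sup>d\<^sup>-\<^sup>1\<close> uniformly over the ball of radius \<open>d\<close>. A vertex \<open>v\<close> receives at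
  least \<open>net_spread G u v\<close> already from the value of \<open>d\<close> that is its distance from \<open>u\<close>.
\<close>
lemma nn_integral_net_spread_le_1:
  assumes "is_network G" "u \<in> verts G"
  shows "(\<integral>\<^sup>+ v. ennreal (net_spread G u v) \<partial>count_space (verts G)) \<le> 1"
proof -
  define B where "B d = verts (net_ball G u d)" for d
  have B: "finite (B d)" "B d \<subseteq> verts G" "u \<in> B d" for d
    using finite_net_ball[OF assms] assms by (auto simp: B_def)
  let ?w = "\<lambda>d. ennreal ((1 / 2) ^ Suc d / card (B d))"
  have "(\<integral>\<^sup>+ v. ennreal (net_spread G u v) \<partial>count_space (verts G)) \<le>
      (\<integral>\<^sup>+ v. (\<Sum>d. ?w d * indicator (B d) v) \<partial>count_space (verts G))"
  proof (rule nn_integral_mono)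
    fix v assume "v \<in> space (count_space (verts G))"
    then have "ennreal (net_spread G u v) = (\<Sum>d\<in>{gdist G u v}. ?w d * indicator (B d) v)"
      by (simp add: net_spread_def B_def)
    also have "\<dots> \<le> (\<Sum>d. ?w d * indicator (B d) v)"
      by (rule sum_le_suminf) simp_all
    finally show "ennreal (net_spread G u v) \<le> (\<Sum>d. ?w d * indicator (B d) v)" .
  qed
  also have "\<dots> = (\<Sum>d. ?w d * emeasure (count_space (verts G)) (B d))"
    by (subst nn_integral_suminf) (simp_all add: B nn_integral_cmult_indicator)
  also have "\<dots> = (\<Sum>d. ennreal ((1 / 2) ^ Suc d))"
  proof (rule arg_cong[where f = suminf], rule ext)
    fix d
    have "B d \<noteq> {}"
      using B(3) by blast
    then show "?w d * emeasure (count_space (verts G)) (B d) = ennreal ((1 / 2) ^ Suc d)"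
      using B[of d]
      by (simp add: ennreal_of_nat_eq_real_of_nat ennreal_mult[symmetric] del: power_Suc)
  qed
  also have "\<dots> = 1"
    using power_half_series by (subst suminf_ennreal2) (auto simp: sums_iff)
  finally show ?thesis .
qed

section \<open>The spreading kernel\<close>

lemma mass_into_spread:
  assumes "is_network G" "u \<in> verts G"
  shows "mass_into spread A (rooted G u) =
    (\<integral>\<^sup>+ v. ennreal (net_spread G u v) * indicator A (rooted G v) \<partial>count_space (verts G))"
  unfolding mass_into_rooted[OF assms]
  by (intro nn_integral_cong) (simp add: spread_doubly_rooted assms)

text \<open>
  Lower semicontinuity: finitely many vertices \<open>v\<close> with \<open>[G, v] \<in> U\<close> already carry more mass than \<open>c\<close>.
  In a network that is close enough to \<open>[G, u]\<close> they have distinct counterparts with the same weights,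
  and the counterparts again lead into \<open>U\<close> since \<open>U\<close> is open.
\<close>
lemma open_mass_into_spread:
  fixes U :: "'x::metric_space rooted_network set"
  assumes U: "open U"
  shows "open {x. c < mass_into spread U x}"
proof (rule openI_near)
  fix x assume "x \<in> {x. c < mass_into spread U x}"
  moreover obtain G u where G: "is_network G" "u \<in> verts G" "x = rooted G u"
    by (rule rooted_exhaust)
  ultimately have c: "c < (\<integral>\<^sup>+ v. ennreal (net_spread G u v) * indicator U (rooted G v) \<partial>count_space (verts G))"
    by (simp add: mass_into_spread)
  let ?h = "\<lambda>v. ennreal (net_spread G u v) * indicator U (rooted G v) * indicator (verts G) v"
  from c have "c < (\<Sum>v. ?h v)"
    by (simp add: nn_integral_count_space_indicator nn_integral_count_space_nat)
  also have "(\<Sum>v. ?h v) = (SUP N. \<Sum>v<N. ?h v)"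
    by (rule suminf_eq_SUP)
  finally obtain N where N: "c < (\<Sum>v<N. ?h v)"
    by (auto simp: less_SUP_iff)
  define F where "F = {v \<in> verts G. v < N \<and> rooted G v \<in> U}"
  have F: "finite F" "F \<subseteq> verts G"
    by (auto simp: F_def)
  have "(\<Sum>v<N. ?h v) = (\<Sum>v\<in>F. ennreal (net_spread G u v))"
    by (rule sum.mono_neutral_cong_right) (auto simp: F_def indicator_def)
  with N have c: "c < (\<Sum>v\<in>F. ennreal (net_spread G u v))"
    by simp
  have "\<forall>v\<in>F. \<exists>n. \<forall>y. near n (1 / Suc n) (rooted G v) y \<longrightarrow> y \<in> U"
    using open_imp_near[OF U] by (auto simp: F_def)
  then obtain n where n: "\<And>v y. v \<in> F \<Longrightarrow> near (n v) (1 / Suc (n v)) (rooted G v) y \<Longrightarrow> y \<in> U"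
    by metis
  \<comment> \<open>The ball of radius \<open>R\<close> contains the ball of radius \<open>n v\<close> about each \<open>v \<in> F\<close>.\<close>
  define R where "R = (\<Sum>v\<in>F. gdist G u v + n v)"
  have R: "gdist G u v + n v \<le> R" if "v \<in> F" for v
    unfolding R_def using that F(1) by (intro member_le_sum) simp_all
  have "c < mass_into spread U y" if y: "near R (1 / Suc R) x y" for y
  proof -
    obtain H u' f g where y_eq: "y = rooted H u'"
      and ball_iso: "ball_iso (\<lambda>a b. dist a b < 1 / Suc R) G H u u' R f g"
      using y G by (auto elim: near_ball_iso)
    interpret ball_iso "\<lambda>a b. dist a b < 1 / Suc R" G H u u' R f g
      by (rule ball_iso)
    have ball: "F \<subseteq> verts (net_ball G u R)"
      using R F(2) by fastforce
    have fF: "f v \<in> verts H" "rooted H (f v) \<in> U" "net_spread H u' (f v) = net_spread G u v" if v: "v \<in> F" for v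
    proof -
      show "f v \<in> verts H"
        using image_in_ball[of v] ball v by auto
      have "1 / Suc R \<le> 1 / Suc (n v)"
        using R[OF v] by (intro divide_left_mono) auto
      then show "rooted H (f v) \<in> U"
        using v F(2) by (intro n[OF v] near_rooted_reroot[OF ball_iso _ R[OF v]]) auto
      show "net_spread H u' (f v) = net_spread G u v"
        using v F(2) R[OF v] by (intro net_spread_image) auto
    qed
    \<comment> \<open>The weights of the counterparts \<open>f ` F\<close> are part of the mass that \<open>[H, u']\<close> sends into \<open>U\<close>.\<close>
    let ?k = "\<lambda>w. ennreal (net_spread H u' w) * indicator U (rooted H w)"
    have inj: "inj_on f F"
      by (rule inj_on_subset[OF net_isoD(1)[OF iso] ball])
    have "(\<Sum>v\<in>F. ennreal (net_spread G u v)) = (\<Sum>v\<in>F. ennreal (net_spread H u' (f v)))"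
      using fF(3) by simp
    also have "\<dots> = (\<Sum>w\<in>f ` F. ennreal (net_spread H u' w))"
      by (simp add: sum.reindex[OF inj])
    also have "\<dots> = (\<Sum>w\<in>f ` F. ?k w * indicator (f ` F) w)"
      using fF(2) by (intro sum.cong) auto
    also have "\<dots> = (\<integral>\<^sup>+ w. ?k w * indicator (f ` F) w \<partial>count_space (verts H))"
      using fF(1) F(1) by (intro nn_integral_count_space'[symmetric]) auto
    also have "\<dots> \<le> mass_into spread U y"
      unfolding y_eq mass_into_spread[OF H] by (intro nn_integral_mono mult_left_le) (simp_all add: indicator_def)
    finally show ?thesis
      using c by (rule less_le_trans[rotated])
  qed
  then show "\<exists>r. \<exists>\<epsilon>>0. \<forall>y. near r \<epsilon> x y \<longrightarrow> y \<in> {x. c < mass_into spread U x}"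
    by (intro exI[of _ R] exI[of _ "1 / Suc R"] conjI) auto
qed


lemma measurable_mass_into_spread:
  "open U \<Longrightarrow> mass_into spread U \<in> borel_measurable (borel :: 'x::metric_space rooted_network measure)"
  by (intro borel_measurableI_greater) (simp add: borel_open open_mass_into_spread)

text \<open>
  The measure does not depend on the representative of the class, see \<open>spread_kernel_rooted\<close>.
\<close>
definition spread_kernel :: "'x::metric_space rooted_network \<Rightarrow> 'x rooted_network measure" where
  "spread_kernel x = (case rep_rooted_network x of (G, u) \<Rightarrow>
     distr (density (count_space (verts G)) (\<lambda>v. ennreal (net_spread G u v))) borel (rooted G))"

lemma sets_spread_kernel [simp]: "sets (spread_kernel x) = sets borel"
  by (simp add: spread_kernel_def split: prod.split)

lemma emeasure_distr_spread:
  assumes G: "is_network G" "u \<in> verts G" and A: "A \<in> sets borel"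
  shows "emeasure (distr (density (count_space (verts G)) (\<lambda>v. ennreal (net_spread G u v))) borel (rooted G)) A =
    mass_into spread A (rooted G u)"
proof -
  let ?D = "density (count_space (verts G)) (\<lambda>v. ennreal (net_spread G u v))"
  have "emeasure (distr ?D borel (rooted G)) A = emeasure ?D (rooted G -` A \<inter> verts G)"
    by (subst emeasure_distr) (simp_all add: A)
  also have "\<dots> = (\<integral>\<^sup>+ v. ennreal (net_spread G u v) * indicator (rooted G -` A \<inter> verts G) v
      \<partial>count_space (verts G))"
    by (rule emeasure_density) simp_all
  also have "\<dots> = mass_into spread A (rooted G u)"
    unfolding mass_into_spread[OF G] by (intro nn_integral_cong) (simp add: indicator_def)
  finally show ?thesis .
qed

lemma emeasure_spread_kernel:
  assumes "A \<in> sets borel"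
  shows "emeasure (spread_kernel x) A = mass_into spread A x"
proof -
  obtain G u where rep: "rep_rooted_network x = (G, u)"
    by fastforce
  moreover have "rooted_iso (rep_rooted_network x) (rep_rooted_network x)"
    and "abs_rooted_network (rep_rooted_network x) = x"
    by (rule Quotient3_rep_reflp[OF Quotient3_rooted_network]
             Quotient3_abs_rep[OF Quotient3_rooted_network])+
  ultimately have "is_network G" "u \<in> verts G" "rooted G u = x"
    by (auto simp: rooted_iso_def rooted_def)
  then show ?thesis
    using emeasure_distr_spread[OF _ _ assms, of G u] by (simp add: spread_kernel_def rep)
qed

lemma spread_kernel_rooted:
  fixes G :: "'x::metric_space network"
  assumes "is_network G" "u \<in> verts G"
  shows "spread_kernel (rooted G u) =
    distr (density (count_space (verts G)) (\<lambda>v. ennreal (net_spread G u v))) borel (rooted G)"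
  by (rule measure_eqI) (simp_all add: emeasure_spread_kernel emeasure_distr_spread assms)

lemma nn_integral_spread_kernel:
  fixes G :: "'x::metric_space network"
  assumes G: "is_network G" "u \<in> verts G" and [measurable]: "\<phi> \<in> borel_measurable borel"
  shows "(\<integral>\<^sup>+ y. \<phi> y \<partial>spread_kernel (rooted G u)) =
    (\<integral>\<^sup>+ v. ennreal (net_spread G u v) * \<phi> (rooted G v) \<partial>count_space (verts G))"
  unfolding spread_kernel_rooted[OF G]
  by (subst nn_integral_distr) (simp_all add: nn_integral_density)

text \<open>
  The open sets are closed under intersections and generate the Borel sets, so measurability of a kernel of
  total mass at most one need only be checked on them.
\<close>
lemma measurable_spread_kernel:
  "(spread_kernel :: 'x::metric_space rooted_network \<Rightarrow> _) \<in> borel \<rightarrow>\<^sub>M subprob_algebra borel"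
proof (rule measurable_subprob_algebra_generated)
  show "sets borel = sigma_sets UNIV {U :: 'x rooted_network set. open U}"
    by (simp add: borel_def)
  show "Int_stable {U :: 'x rooted_network set. open U}"
    by (auto simp: Int_stable_def)
  show "subprob_space (spread_kernel x)" for x :: "'x rooted_network"
  proof
    obtain G u where G: "is_network G" "u \<in> verts G" "x = rooted G u"
      by (rule rooted_exhaust)
    have "space (spread_kernel x) = UNIV"
      using sets_eq_imp_space_eq[OF sets_spread_kernel[of x]] by simp
    then show "emeasure (spread_kernel x) (space (spread_kernel x)) \<le> 1"
      using nn_integral_net_spread_le_1[OF G(1,2)]
      by (simp add: emeasure_spread_kernel G(3) mass_into_spread[OF G(1,2)])
    show "space (spread_kernel x) \<noteq> {}"
      using \<open>space (spread_kernel x) = UNIV\<close> by simp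
  qed
  show "(\<lambda>x. emeasure (spread_kernel x) U) \<in> borel_measurable borel"
    if "U \<in> {U :: 'x rooted_network set. open U}" for U
    using measurable_mass_into_spread[of U] that by (simp add: emeasure_spread_kernel)
  show "(\<lambda>x :: 'x rooted_network. emeasure (spread_kernel x) UNIV) \<in> borel_measurable borel"
    using measurable_mass_into_spread[of UNIV] by (simp add: emeasure_spread_kernel)
qed simp_all

text \<open>
  The equivalence relation whose measurable saturated sets are the invariant sets.
\<close>
definition same_network :: "'x rooted_network \<Rightarrow> 'x rooted_network \<Rightarrow> bool" where
  "same_network x y \<longleftrightarrow>
     (\<exists>G u v. is_network G \<and> u \<in> verts G \<and> v \<in> verts G \<and> x = rooted G u \<and> y = rooted G v)"

lemma same_network_rooted:
  assumes "is_network G" "u \<in> verts G"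
  shows "same_network (rooted G u) y \<longleftrightarrow> (\<exists>v\<in>verts G. y = rooted G v)"
proof
  assume "same_network (rooted G u) y"
  then obtain H u' v' where H: "is_network H" "u' \<in> verts H" "v' \<in> verts H"
    "rooted H u' = rooted G u" "y = rooted H v'"
    unfolding same_network_def by metis
  from rooted_eqD[OF H(1,2) assms H(4)] obtain f g where "net_iso (=) H G f g"
    by (auto simp: rooted_iso_def)
  from rooted_map[OF this H(1) assms(1) H(3)] net_isoD(8)[OF this H(3)]
  show "\<exists>v\<in>verts G. y = rooted G v"
    using H(5) by metis
next
  assume "\<exists>v\<in>verts G. y = rooted G v"
  then show "same_network (rooted G u) y"
    using assms unfolding same_network_def by blast
qed

lemma equivp_same_network: "equivp (same_network :: 'x rooted_network \<Rightarrow> _)"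
proof (rule equivpI)
  show "reflp (same_network :: 'x rooted_network \<Rightarrow> _)"
  proof (rule reflpI)
    fix x :: "'x rooted_network"
    obtain G u where "is_network G" "u \<in> verts G" "x = rooted G u"
      by (rule rooted_exhaust)
    then show "same_network x x"
      unfolding same_network_def by blast
  qed
  show "symp (same_network :: 'x rooted_network \<Rightarrow> _)"
    by (rule sympI) (auto simp: same_network_def)
  show "transp (same_network :: 'x rooted_network \<Rightarrow> _)"
  proof (rule transpI)
    fix x y z :: "'x rooted_network" assume xy: "same_network x y" and yz: "same_network y z"
    from xy obtain G u v where G: "is_network G" "u \<in> verts G" "v \<in> verts G"
      "x = rooted G u" "y = rooted G v"
      unfolding same_network_def by blast
    then show "same_network x z"
      using yz by (simp add: same_network_rooted)
  qed
qed

lemma spread_kernel_null_iff: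
  fixes A :: "'x::metric_space rooted_network set"
  assumes "A \<in> sets borel"
  shows "emeasure (spread_kernel x) A = 0 \<longleftrightarrow> (\<forall>y\<in>A. \<not> same_network x y)"
proof -
  obtain G u where G: "is_network G" "u \<in> verts G" "x = rooted G u"
    by (rule rooted_exhaust)
  have "emeasure (spread_kernel x) A = 0 \<longleftrightarrow>
      (\<forall>v\<in>verts G. ennreal (net_spread G u v) * indicator A (rooted G v) = 0)"
    unfolding emeasure_spread_kernel[OF assms] G(3) mass_into_spread[OF G(1,2)]
    by (subst nn_integral_0_iff_AE) (simp_all add: AE_count_space)
  also have "\<dots> \<longleftrightarrow> (\<forall>v\<in>verts G. rooted G v \<notin> A)"
    by (simp add: indicator_def ennreal_eq_0_iff not_le[THEN iffD2, OF net_spread_pos[OF G(1,2)]])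
  finally show ?thesis
    unfolding G(3) same_network_rooted[OF G(1,2)] by blast
qed

lemma invariant_sets_iff:
  "A \<in> invariant_sets \<longleftrightarrow> A \<in> sets borel \<and> (\<forall>x\<in>A. \<forall>y. same_network x y \<longrightarrow> y \<in> A)"
  unfolding invariant_sets_def same_network_def by blast

section \<open>Root-changes and invariant sets\<close>

text \<open>
  All vertices of a network lie on the same side of an invariant set.
\<close>
lemma mass_into_invariant:
  assumes A: "A \<in> invariant_sets"
  shows "mass_into T A x = out_mass T x * indicator A x"
proof -
  obtain G u where G: "is_network G" "u \<in> verts G" "x = rooted G u"
    by (rule rooted_exhaust)
  have "rooted G v \<in> A \<longleftrightarrow> rooted G u \<in> A" if "v \<in> verts G" for v
    using A G(1,2) that unfolding invariant_sets_def by blast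
  then have "indicator A (rooted G v) = (indicator A (rooted G u) :: ennreal)" if "v \<in> verts G" for v
    using that by (simp add: indicator_def)
  then have "mass_into T A (rooted G u) =
      (\<integral>\<^sup>+ v. ennreal (T (doubly_rooted G u v)) * indicator A (rooted G u) \<partial>count_space (verts G))"
    unfolding mass_into_rooted[OF G(1,2)] by (intro nn_integral_cong) simp
  also have "\<dots> = out_mass T (rooted G u) * indicator A (rooted G u)"
    unfolding out_mass_rooted[OF G(1,2)] by (rule nn_integral_multc) simp
  finally show ?thesis
    unfolding G(3) .
qed

lemma mass_into_UNIV: "mass_into T UNIV x = out_mass T x"
proof -
  obtain G u where G: "is_network G" "u \<in> verts G" "x = rooted G u"
    by (rule rooted_exhaust)
  show ?thesis
    unfolding G(3) mass_into_rooted[OF G(1,2)] out_mass_rooted[OF G(1,2)] by simp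
qed

lemma root_change_preserves_invariant:
  assumes T: "is_root_change T M X M' X'" and A: "A \<in> invariant_sets"
    and X: "X \<in> borel_measurable M"
  shows "emeasure M {\<omega> \<in> space M. X \<omega> \<in> A} = emeasure M' {\<omega> \<in> space M'. X' \<omega> \<in> A}"
proof -
  have A': "A \<in> sets borel"
    using A by (simp add: invariant_sets_def)
  have out: "AE \<omega> in M. out_mass T (X \<omega>) = 1"
    using T by (simp add: is_root_change_def)
  have "emeasure M' {\<omega> \<in> space M'. X' \<omega> \<in> A} = (\<integral>\<^sup>+ \<omega>. mass_into T A (X \<omega>) \<partial>M)"
    using T A' by (simp add: is_root_change_def)
  also have "\<dots> = (\<integral>\<^sup>+ \<omega>. indicator {\<omega> \<in> space M. X \<omega> \<in> A} \<omega> \<partial>M)"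
  proof (rule nn_integral_cong_AE)
    show "AE \<omega> in M. mass_into T A (X \<omega>) = indicator {\<omega> \<in> space M. X \<omega> \<in> A} \<omega>"
      using out AE_space by eventually_elim (simp add: mass_into_invariant[OF A] indicator_def)
  qed
  also have "\<dots> = emeasure M {\<omega> \<in> space M. X \<omega> \<in> A}"
    by (rule nn_integral_indicator) (use measurable_sets[OF X A'] in \<open>simp add: vimage_def Int_def conj_commute\<close>)
  finally show ?thesis
    by (rule sym)
qed

context
  fixes a b :: "nat \<Rightarrow> 'x::metric_space rooted_network \<Rightarrow> ennreal"
  assumes a [measurable]: "\<And>n. a n \<in> borel_measurable borel"
    and b [measurable]: "\<And>n. b n \<in> borel_measurable borel"
    and bound: "\<And>x. (\<Sum>n. a n x * (\<integral>\<^sup>+ y. b n y \<partial>spread_kernel x)) \<le> 1"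
begin

text \<open>
  The density of the combined rounds as a function of the doubly-rooted network. It is bounded by
  its sum over all destinations, hence by one, and can be read as a real number.
\<close>
definition transport_series :: "'x doubly_rooted_network \<Rightarrow> ennreal" where
  "transport_series z = (\<Sum>n. ennreal (spread z) * a n (first_root z) * b n (second_root z))"

lemma nn_integral_transport_series:
  assumes G: "is_network G" "u \<in> verts G" and A [measurable]: "A \<in> sets borel"
  shows "(\<integral>\<^sup>+ v. transport_series (doubly_rooted G u v) * indicator A (rooted G v) \<partial>count_space (verts G)) =
    (\<Sum>n. a n (rooted G u) * (\<integral>\<^sup>+ y. b n y * indicator A y \<partial>spread_kernel (rooted G u)))"
proof -
  have "(\<integral>\<^sup>+ v. transport_series (doubly_rooted G u v) * indicator A (rooted G v) \<partial>count_space (verts G)) =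
      (\<integral>\<^sup>+ v. (\<Sum>n. a n (rooted G u) *
        (ennreal (net_spread G u v) * (b n (rooted G v) * indicator A (rooted G v))))
        \<partial>count_space (verts G))"
    unfolding transport_series_def ennreal_suminf_multc[symmetric]
    by (intro nn_integral_cong)
       (simp add: G roots_doubly_rooted spread_doubly_rooted mult_ac
          del: ennreal_suminf_multc ennreal_suminf_cmult)
  also have "\<dots> = (\<Sum>n. a n (rooted G u) *
      (\<integral>\<^sup>+ v. ennreal (net_spread G u v) * (b n (rooted G v) * indicator A (rooted G v))
        \<partial>count_space (verts G)))"
    by (subst nn_integral_suminf) (simp_all add: nn_integral_cmult)
  finally show ?thesis
    by (simp add: nn_integral_spread_kernel G)
qed

lemma transport_series_le_1: "transport_series z \<le> 1"
proof -
  obtain G u v where G: "is_network G" "u \<in> verts G" "v \<in> verts G" "z = doubly_rooted G u v"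
    by (rule doubly_rooted_exhaust)
  have "transport_series z \<le> (\<integral>\<^sup>+ v. transport_series (doubly_rooted G u v) \<partial>count_space (verts G))"
    unfolding G(4) using G(3) by (rule nn_integral_ge_point)
  also have "\<dots> \<le> 1"
    using nn_integral_transport_series[OF G(1,2), of UNIV] bound by simp
  finally show ?thesis .
qed

definition transport :: "'x doubly_rooted_network \<Rightarrow> real" where
  "transport z = enn2real (transport_series z)"

lemma ennreal_transport: "ennreal (transport z) = transport_series z"
  unfolding transport_def using transport_series_le_1[of z]
  by (intro ennreal_enn2real) (metis ennreal_one_less_top le_less_trans)

lemma measurable_transport: "transport \<in> borel_measurable borel"
  unfolding transport_def[abs_def] transport_series_def[abs_def] by measurable

lemma mass_into_transport:
  assumes "A \<in> sets borel"
  shows "mass_into transport A x = (\<Sum>n. a n x * (\<integral>\<^sup>+ y. b n y * indicator A y \<partial>spread_kernel x))"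
proof -
  obtain G u where G: "is_network G" "u \<in> verts G" "x = rooted G u"
    by (rule rooted_exhaust)
  show ?thesis
    unfolding G(3) mass_into_rooted[OF G(1,2)] ennreal_transport
    by (rule nn_integral_transport_series[OF G(1,2) assms])
qed

end

lemma class_kernel_spread:
  "class_kernel (borel :: 'x::metric_space rooted_network measure) spread_kernel same_network"
  by unfold_locales (auto simp: measurable_spread_kernel equivp_same_network spread_kernel_null_iff)

lemma root_change_exists:
  fixes X :: "'a \<Rightarrow> 'x::metric_space rooted_network" and X' :: "'b \<Rightarrow> 'x rooted_network"
  assumes X: "random_rooted_network M X" and X': "random_rooted_network M' X'"
    and agree: "\<And>A. A \<in> invariant_sets \<Longrightarrow>
      emeasure M {\<omega> \<in> space M. X \<omega> \<in> A} = emeasure M' {\<omega> \<in> space M'. X' \<omega> \<in> A}"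
  shows "\<exists>T. is_root_change T M X M' X'"
proof -
  interpret M: prob_space M
    using X by (simp add: random_rooted_network_def)
  interpret M': prob_space M'
    using X' by (simp add: random_rooted_network_def)
  have [measurable]: "X \<in> borel_measurable M" "X' \<in> borel_measurable M'"
    using X X' by (simp_all add: random_rooted_network_def)
  let ?\<mu> = "distr M borel X" and ?\<nu> = "distr M' borel X'"
  have law: "emeasure ?\<mu> A = emeasure M {\<omega> \<in> space M. X \<omega> \<in> A}"
    "emeasure ?\<nu> A = emeasure M' {\<omega> \<in> space M'. X' \<omega> \<in> A}" if "A \<in> sets borel" for A
    using that by (simp_all add: emeasure_distr vimage_def Int_def conj_commute)
  interpret class_kernel "borel :: 'x rooted_network measure" spread_kernel same_network
    by (rule class_kernel_spread)
  interpret equidistributed "borel :: 'x rooted_network measure" spread_kernel same_network ?\<mu> ?\<nu>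
  proof (rule equidistributed.intro[OF class_kernel_spread], rule equidistributed_axioms.intro)
    show "finite_measure ?\<mu>" "finite_measure ?\<nu>"
      by (auto intro!: prob_space.finite_measure M.prob_space_distr M'.prob_space_distr)
    show "emeasure ?\<mu> A = emeasure ?\<nu> A" if "invariant A" for A
      using that agree[of A] by (simp add: invariant_def invariant_sets_iff law)
  qed simp_all
  obtain a b where a [measurable]: "\<And>n. a n \<in> borel_measurable borel"
    and b [measurable]: "\<And>n. b n \<in> borel_measurable borel"
    and le: "\<And>x. (\<Sum>n. a n x * (\<integral>\<^sup>+ y. b n y \<partial>spread_kernel x)) \<le> 1"
    and full: "AE x in ?\<mu>. (\<Sum>n. a n x * (\<integral>\<^sup>+ y. b n y \<partial>spread_kernel x)) = 1"
    and moved: "\<And>A. A \<in> sets borel \<Longrightarrow> emeasure ?\<nu> A =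
      (\<Sum>n. \<integral>\<^sup>+ x. a n x * (\<integral>\<^sup>+ y. b n y * indicator A y \<partial>spread_kernel x) \<partial>?\<mu>)"
    by (rule transport_exists) auto
  note T = measurable_transport[OF a b le] mass_into_transport[OF a b le]
  have "is_root_change (transport a b) M X M' X'"
    unfolding is_root_change_def
  proof (intro conjI allI ballI)
    show "transport a b \<in> borel_measurable borel"
      by (rule T(1))
    show "0 \<le> transport a b z" for z
      unfolding transport_def[OF a b le] by simp
    show "AE \<omega> in M. out_mass (transport a b) (X \<omega>) = 1"
      using AE_distrD[OF _ full] by (simp add: mass_into_UNIV[symmetric] T(2))
    fix A :: "'x rooted_network set" assume A [measurable]: "A \<in> sets borel"
    have [measurable]: "(\<lambda>x. \<integral>\<^sup>+ y. b n y * indicator A y \<partial>spread_kernel x) \<in> borel_measurable borel" for n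
      using measurable_avg[of "\<lambda>y. b n y * indicator A y"] by (simp add: avg_def[abs_def])
    have "emeasure M' {\<omega> \<in> space M'. X' \<omega> \<in> A} =
        (\<Sum>n. \<integral>\<^sup>+ x. a n x * (\<integral>\<^sup>+ y. b n y * indicator A y \<partial>spread_kernel x) \<partial>?\<mu>)"
      using moved[OF A] law(2)[OF A] by simp
    also have "\<dots> = (\<integral>\<^sup>+ x. mass_into (transport a b) A x \<partial>?\<mu>)"
      unfolding T(2)[OF A] by (subst nn_integral_suminf) simp_all
    also have "\<dots> = (\<integral>\<^sup>+ \<omega>. mass_into (transport a b) A (X \<omega>) \<partial>M)"
      unfolding T(2)[OF A] by (subst nn_integral_distr) simp_all
    finally show "emeasure M' {\<omega> \<in> space M'. X' \<omega> \<in> A} =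
        (\<integral>\<^sup>+ \<omega>. mass_into (transport a b) A (X \<omega>) \<partial>M)" .
  qed
  then show ?thesis
    by blast
qed

theorem theorem1:
  fixes M :: "'a measure" and X :: "'a \<Rightarrow> 'x::polish_space rooted_network"
    and M' :: "'b measure" and X' :: "'b \<Rightarrow> 'x rooted_network"
  assumes "random_rooted_network M X" and "random_rooted_network M' X'"
  shows "(\<exists>T. is_root_change T M X M' X') \<longleftrightarrow>
    (\<forall>A\<in>invariant_sets. \<P>(\<omega> in M. X \<omega> \<in> A) = \<P>(\<omega> in M'. X' \<omega> \<in> A))"
proof -
  interpret M: prob_space M
    using assms(1) by (simp add: random_rooted_network_def)
  interpret M': prob_space M'
    using assms(2) by (simp add: random_rooted_network_def)
  have X: "X \<in> borel_measurable M"
    using assms(1) by (simp add: random_rooted_network_def)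
  show ?thesis
  proof
    assume "\<exists>T. is_root_change T M X M' X'"
    then obtain T where T: "is_root_change T M X M' X'" ..
    show "\<forall>A\<in>invariant_sets. \<P>(\<omega> in M. X \<omega> \<in> A) = \<P>(\<omega> in M'. X' \<omega> \<in> A)"
    proof
      fix A :: "'x rooted_network set" assume "A \<in> invariant_sets"
      then show "\<P>(\<omega> in M. X \<omega> \<in> A) = \<P>(\<omega> in M'. X' \<omega> \<in> A)"
        unfolding measure_def by (simp only: root_change_preserves_invariant[OF T _ X])
    qed
  next
    assume "\<forall>A\<in>invariant_sets. \<P>(\<omega> in M. X \<omega> \<in> A) = \<P>(\<omega> in M'. X' \<omega> \<in> A)"
    then show "\<exists>T. is_root_change T M X M' X'"
      by (intro root_change_exists[OF assms]) (simp add: M.emeasure_eq_measure M'.emeasure_eq_measure)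
  qed
qed

end
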